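(* Let $G$ be an infinite countable group. Then there is a locally compact $\sigma$-compact Hausdorff space $X$ on which $G$ acts freely and with a dense orbit, such that there is no non-zero $G$-invariant Radon measure on $X$. If $G$ is supramenable, then the action is necessarily not co-compact. The space $X$ can be chosen to be an open invariant subset of $\beta G$.
   Context: Groups are discrete and act by homeomorphisms; an action is free if $g.x=x$ for some $x$ implies $g=e$. An action on a locally compact Hausdorff space $X$ is co-compact if there is a compact $K\subseteq X$ with $\bigcup_{g\in G}g.K=X$. $\beta G$ is the Stone–Čech compactification of the discrete space $G$, with the $G$-action extending left multiplication of $G$ on itself. A non-empty subset $A\subseteq G$ is paradoxical if there are pairwise disjoint subsets $V_1,\dots,V_{n+m}$ of $A$ and elements $t_1,\dots,t_{n+m}\in G$ such that $\bigcup_{i=1}^{n}t_iV_i=A=\bigcup_{i=n+1}^{n+m}t_iV_i$. $G$ is supramenable if it contains no non-empty paradoxical subset. *)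

theory Defs
  imports "HOL-Analysis.Analysis" "HOL-Algebra.Group_Action"
begin

section \<open>Actions on topological spaces\<close>

definition topological_action ::
    "('g, 'm) monoid_scheme \<Rightarrow> 'x topology \<Rightarrow> ('g \<Rightarrow> 'x \<Rightarrow> 'x) \<Rightarrow> bool" where
  "topological_action G X \<phi> \<longleftrightarrow>
     group_action G (topspace X) \<phi> \<and> (\<forall>g\<in>carrier G. homeomorphic_map X X (\<phi> g))"

definition free_action ::
    "('g, 'm) monoid_scheme \<Rightarrow> 'x topology \<Rightarrow> ('g \<Rightarrow> 'x \<Rightarrow> 'x) \<Rightarrow> bool" where
  "free_action G X \<phi> \<longleftrightarrow>
     (\<forall>g\<in>carrier G. \<forall>x\<in>topspace X. \<phi> g x = x \<longrightarrow> g = \<one>\<^bsub>G\<^esub>)"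

definition has_dense_orbit ::
    "('g, 'm) monoid_scheme \<Rightarrow> 'x topology \<Rightarrow> ('g \<Rightarrow> 'x \<Rightarrow> 'x) \<Rightarrow> bool" where
  "has_dense_orbit G X \<phi> \<longleftrightarrow> (\<exists>x\<in>topspace X. X closure_of (orbit G \<phi> x) = topspace X)"

definition cocompact_action ::
    "('g, 'm) monoid_scheme \<Rightarrow> 'x topology \<Rightarrow> ('g \<Rightarrow> 'x \<Rightarrow> 'x) \<Rightarrow> bool" where
  "cocompact_action G X \<phi> \<longleftrightarrow>
     (\<exists>K. compactin X K \<and> (\<Union>g\<in>carrier G. \<phi> g ` K) = topspace X)"

definition sigma_compact_space :: "'x topology \<Rightarrow> bool" where
  "sigma_compact_space X \<longleftrightarrow>
     (\<exists>K :: nat \<Rightarrow> 'x set. (\<forall>n. compactin X (K n)) \<and> (\<Union>n. K n) = topspace X)"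


section \<open>Radon measures\<close>

text \<open>Borel measures that are finite on compact sets, outer regular on Borel sets and inner
  regular on open sets. On a locally compact \<open>\<sigma>\<close>-compact Hausdorff space such a measure is
  automatically inner regular on all Borel sets, so the usual variants of the definition agree.\<close>

definition radon_measure :: "'x topology \<Rightarrow> 'x measure \<Rightarrow> bool" where
  "radon_measure X M \<longleftrightarrow>
     sets M = sets (sigma (topspace X) {U. openin X U}) \<and>
     (\<forall>K. compactin X K \<longrightarrow> emeasure M K < \<infinity>) \<and>
     (\<forall>A\<in>sets M. emeasure M A = (INF U\<in>{U. openin X U \<and> A \<subseteq> U}. emeasure M U)) \<and>
     (\<forall>U. openin X U \<longrightarrow> emeasure M U = (SUP K\<in>{K. compactin X K \<and> K \<subseteq> U}. emeasure M K))"

definition invariant_measure ::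
    "('g, 'm) monoid_scheme \<Rightarrow> ('g \<Rightarrow> 'x \<Rightarrow> 'x) \<Rightarrow> 'x measure \<Rightarrow> bool" where
  "invariant_measure G \<phi> M \<longleftrightarrow>
     (\<forall>g\<in>carrier G. \<forall>A\<in>sets M. emeasure M (\<phi> g ` A) = emeasure M A)"

definition has_nonzero_invariant_radon_measure ::
    "('g, 'm) monoid_scheme \<Rightarrow> 'x topology \<Rightarrow> ('g \<Rightarrow> 'x \<Rightarrow> 'x) \<Rightarrow> bool" where
  "has_nonzero_invariant_radon_measure G X \<phi> \<longleftrightarrow>
     (\<exists>M. radon_measure X M \<and> invariant_measure G \<phi> M \<and> emeasure M (topspace X) \<noteq> 0)"


section \<open>Supramenable groups\<close>

definition paradoxical :: "('g, 'm) monoid_scheme \<Rightarrow> 'g set \<Rightarrow> bool" where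
  "paradoxical G A \<longleftrightarrow>
     A \<noteq> {} \<and> A \<subseteq> carrier G \<and>
     (\<exists>(n::nat) (m::nat) (V :: nat \<Rightarrow> 'g set) (t :: nat \<Rightarrow> 'g).
        (\<forall>i\<in>{1..n+m}. V i \<subseteq> A \<and> t i \<in> carrier G) \<and>
        disjoint_family_on V {1..n+m} \<and>
        (\<Union>i\<in>{1..n}. t i <#\<^bsub>G\<^esub> V i) = A \<and>
        (\<Union>i\<in>{n+1..n+m}. t i <#\<^bsub>G\<^esub> V i) = A)"

definition supramenable :: "('g, 'm) monoid_scheme \<Rightarrow> bool" where
  "supramenable G \<longleftrightarrow> \<not> (\<exists>A. paradoxical G A)"


section \<open>The Stone-Cech compactification of a discrete space\<close>

text \<open>The points are the ultrafilters on \<open>S\<close>, carried by the type of filters on the ambient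
  type; \<open>s \<in> S\<close> corresponds to the principal ultrafilter \<open>principal {s}\<close>. The lemmas below
  show that this is a compact Hausdorff space in which the discrete space \<open>S\<close> is densely
  embedded, with the universal property for maps into compact Hausdorff spaces.\<close>

definition ultrafilters_on :: "'a set \<Rightarrow> 'a filter set" where
  "ultrafilters_on S =
     {U. U \<noteq> bot \<and> eventually (\<lambda>x. x \<in> S) U \<and>
         (\<forall>P. eventually P U \<or> eventually (\<lambda>x. \<not> P x) U)}"

definition stone_cech :: "'a set \<Rightarrow> 'a filter topology" where
  "stone_cech S =
     topology_generated_by ((\<lambda>A. {U \<in> ultrafilters_on S. eventually (\<lambda>x. x \<in> A) U}) ` Pow S)"

text \<open>The functions are restricted to \<open>X\<close> because bijections of a set are extensional in
  \<^const>\<open>BijGroup\<close>.\<close>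

definition stone_cech_action ::
    "('g, 'm) monoid_scheme \<Rightarrow> 'g filter set \<Rightarrow> 'g \<Rightarrow> 'g filter \<Rightarrow> 'g filter" where
  "stone_cech_action G X = (\<lambda>g. \<lambda>U\<in>X. filtermap (\<lambda>h. g \<otimes>\<^bsub>G\<^esub> h) U)"

lemma topspace_stone_cech [simp]: "topspace (stone_cech S) = ultrafilters_on S"
  by (auto simp: stone_cech_def ultrafilters_on_def)

lemma ultrafilters_on_not:
  assumes "U \<in> ultrafilters_on S"
  shows "eventually (\<lambda>x. \<not> P x) U \<longleftrightarrow> \<not> eventually P U"
proof
  assume "eventually (\<lambda>x. \<not> P x) U"
  then have "eventually (\<lambda>x. False) U" if "eventually P U"
    using that by (rule eventually_elim2) auto
  with assms show "\<not> eventually P U"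
    by (auto simp: ultrafilters_on_def eventually_False)
qed (use assms in \<open>auto simp: ultrafilters_on_def\<close>)

lemma openin_stone_cech_basic:
  "openin (stone_cech S) {U \<in> ultrafilters_on S. eventually P U}"
proof -
  have "{U \<in> ultrafilters_on S. eventually P U} =
        {U \<in> ultrafilters_on S. eventually (\<lambda>x. x \<in> {x\<in>S. P x}) U}"
    by (auto simp: ultrafilters_on_def eventually_conj_iff)
  moreover have "openin (stone_cech S) \<dots>"
    unfolding stone_cech_def by (intro topology_generated_by_Basis image_eqI[OF refl]) auto
  ultimately show ?thesis by simp
qed

lemma principal_in_ultrafilters_on: "s \<in> S \<Longrightarrow> principal {s} \<in> ultrafilters_on S"
  by (auto simp: ultrafilters_on_def eventually_principal principal_eq_bot_iff)

lemma ultrafilter_exists: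
  assumes "F \<noteq> bot" "eventually (\<lambda>x. x \<in> S) F"
  obtains U where "U \<in> ultrafilters_on S" "U \<le> F"
proof -
  let ?A = "{H. H \<noteq> bot \<and> H \<le> F}"
  have po: "partial_order_on ?A (relation_of (\<lambda>a b. b \<le> a) ?A)"
    by (intro partial_order_on_relation_ofI) auto
  have "\<exists>u\<in>?A. \<forall>a\<in>C. u \<le> a" if C: "C \<in> Chains (relation_of (\<lambda>a b. b \<le> a) ?A)" for C
  proof (cases "C = {}")
    case True
    then show ?thesis using assms by auto
  next
    case False
    have sub: "C \<subseteq> ?A" and lin: "\<And>a b. a \<in> C \<Longrightarrow> b \<in> C \<Longrightarrow> a \<le> b \<or> b \<le> a"
      using C by (auto simp: Chains_def relation_of_def)
    have "eventually (\<lambda>x. False) (Inf C) \<longleftrightarrow> (\<exists>b\<in>C. eventually (\<lambda>x. False) b)"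
      by (rule eventually_Inf_base[OF False]) (metis inf.orderE inf.commute lin order_refl)
    with sub have "Inf C \<noteq> bot"
      by (auto simp: eventually_False)
    moreover have "Inf C \<le> F"
      using False sub by (metis (no_types, lifting) Inf_lower2 ex_in_conv mem_Collect_eq subsetD)
    ultimately show ?thesis
      by (auto intro: Inf_lower)
  qed
  from predicate_Zorn[OF po this] obtain U
    where U: "U \<noteq> bot" "U \<le> F" and max: "\<And>H. H \<noteq> bot \<Longrightarrow> H \<le> F \<Longrightarrow> H \<le> U \<Longrightarrow> H = U"
    by auto
  have "eventually P U \<or> eventually (\<lambda>x. \<not> P x) U" for P
  proof (rule disjCI)
    assume "\<not> eventually (\<lambda>x. \<not> P x) U"
    then have "inf U (principal (Collect P)) \<noteq> bot"
      by (simp add: eventually_False[symmetric] eventually_inf_principal)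
    moreover have "inf U (principal (Collect P)) \<le> U"
      by simp
    ultimately have "inf U (principal (Collect P)) = U"
      using max U(2) by (meson order_trans)
    then have "U \<le> principal (Collect P)"
      by (metis inf.cobounded2)
    then show "eventually P U"
      by (simp add: le_principal)
  qed
  moreover have "eventually (\<lambda>x. x \<in> S) U"
    using assms(2) U(2) by (rule filter_leD[rotated])
  ultimately have "U \<in> ultrafilters_on S"
    using U(1) by (auto simp: ultrafilters_on_def)
  with U(2) that show ?thesis by blast
qed

lemma Hausdorff_space_stone_cech: "Hausdorff_space (stone_cech S)"
  unfolding Hausdorff_space_def
proof (intro allI impI)
  fix U V
  assume UV: "U \<in> topspace (stone_cech S) \<and> V \<in> topspace (stone_cech S) \<and> U \<noteq> V"
  then obtain P where P: "eventually P U" "\<not> eventually P V"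
    by (metis (no_types, lifting) filter_eq_iff topspace_stone_cech ultrafilters_on_not)
  let ?A = "{W \<in> ultrafilters_on S. eventually P W}"
  let ?B = "{W \<in> ultrafilters_on S. eventually (\<lambda>x. \<not> P x) W}"
  have "openin (stone_cech S) ?A" "openin (stone_cech S) ?B"
    by (rule openin_stone_cech_basic)+
  moreover have "U \<in> ?A" "V \<in> ?B"
    using UV P by (auto simp: ultrafilters_on_not)
  moreover have "disjnt ?A ?B"
    by (auto simp: disjnt_iff ultrafilters_on_not)
  ultimately show "\<exists>A B. openin (stone_cech S) A \<and> openin (stone_cech S) B \<and>
      U \<in> A \<and> V \<in> B \<and> disjnt A B"
    by blast
qed

lemma openin_stone_cech_nbhd:
  assumes "openin (stone_cech S) W" "U \<in> W"
  obtains A where "A \<subseteq> S" "eventually (\<lambda>x. x \<in> A) U"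
    "\<And>V. V \<in> ultrafilters_on S \<Longrightarrow> eventually (\<lambda>x. x \<in> A) V \<Longrightarrow> V \<in> W"
proof -
  have "generate_topology_on ((\<lambda>A. {U \<in> ultrafilters_on S. eventually (\<lambda>x. x \<in> A) U}) ` Pow S) W"
    using assms(1) by (simp add: stone_cech_def openin_topology_generated_by)
  then have "\<forall>U\<in>W. \<exists>A\<subseteq>S. eventually (\<lambda>x. x \<in> A) U \<and>
      (\<forall>V\<in>ultrafilters_on S. eventually (\<lambda>x. x \<in> A) V \<longrightarrow> V \<in> W)"
  proof induction
    case Empty
    then show ?case by simp
  next
    case (Int a b)
    show ?case
    proof
      fix U assume "U \<in> a \<inter> b"
      with Int.IH obtain A B where
        "A \<subseteq> S" "eventually (\<lambda>x. x \<in> A) U"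
        "\<forall>V\<in>ultrafilters_on S. eventually (\<lambda>x. x \<in> A) V \<longrightarrow> V \<in> a"
        "B \<subseteq> S" "eventually (\<lambda>x. x \<in> B) U"
        "\<forall>V\<in>ultrafilters_on S. eventually (\<lambda>x. x \<in> B) V \<longrightarrow> V \<in> b"
        by (metis IntE)
      then show "\<exists>A\<subseteq>S. eventually (\<lambda>x. x \<in> A) U \<and>
          (\<forall>V\<in>ultrafilters_on S. eventually (\<lambda>x. x \<in> A) V \<longrightarrow> V \<in> a \<inter> b)"
        by (intro exI[of _ "A \<inter> B"]) (auto simp: eventually_conj_iff)
    qed
  next
    case (UN K)
    show ?case
    proof
      fix U assume "U \<in> \<Union>K"
      then obtain k where k: "k \<in> K" "U \<in> k" by blast
      with UN.IH obtain A where "A \<subseteq> S" "eventually (\<lambda>x. x \<in> A) U"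
        "\<forall>V\<in>ultrafilters_on S. eventually (\<lambda>x. x \<in> A) V \<longrightarrow> V \<in> k"
        by meson
      with k show "\<exists>A\<subseteq>S. eventually (\<lambda>x. x \<in> A) U \<and>
          (\<forall>V\<in>ultrafilters_on S. eventually (\<lambda>x. x \<in> A) V \<longrightarrow> V \<in> \<Union>K)"
        by blast
    qed
  next
    case (Basis s)
    then show ?case by auto
  qed
  with assms(2) that show thesis by blast
qed

lemma compact_space_stone_cech: "compact_space (stone_cech S)"
  unfolding compact_space_alt
proof (intro allI impI)
  fix \<U> assume \<U>: "(\<forall>W\<in>\<U>. openin (stone_cech S) W) \<and> topspace (stone_cech S) \<subseteq> \<Union>\<U>"
  let ?N = "\<lambda>A. {V \<in> ultrafilters_on S. eventually (\<lambda>x. x \<in> A) V}"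
  let ?\<A> = "{A. A \<subseteq> S \<and> (\<exists>W\<in>\<U>. ?N A \<subseteq> W)}"
  let ?F = "inf (principal S) (INF A\<in>?\<A>. principal (S - A))"
  have "?F = bot"
  proof (rule ccontr)
    assume "?F \<noteq> bot"
    moreover have "eventually (\<lambda>x. x \<in> S) ?F"
      unfolding le_principal[symmetric] by (rule inf.cobounded1)
    ultimately obtain U where U: "U \<in> ultrafilters_on S" "U \<le> ?F"
      by (rule ultrafilter_exists)
    obtain W where W: "W \<in> \<U>" "U \<in> W"
      using \<U> U(1) unfolding topspace_stone_cech by blast
    obtain A where A: "A \<subseteq> S" "eventually (\<lambda>x. x \<in> A) U" "?N A \<subseteq> W"
    proof (rule openin_stone_cech_nbhd[of S W U])
      show "openin (stone_cech S) W" using \<U> W(1) by blast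
    qed (use W(2) that in blast)+
    have "U \<le> principal (S - A)"
      by (rule order_trans[OF U(2) le_infI2[OF INF_lower]]) (use W A in auto)
    then have "eventually (\<lambda>x. x \<notin> A) U"
      by (simp add: le_principal eventually_conj_iff)
    with A(2) U(1) show False
      by (simp add: ultrafilters_on_not)
  qed
  then have "eventually (\<lambda>x. False) (inf (INF A\<in>?\<A>. principal (S - A)) (principal S))"
    by (simp only: inf.commute eventually_False)
  then have "eventually (\<lambda>x. x \<notin> S) (INF A\<in>?\<A>. principal (S - A))"
    by (simp only: eventually_inf_principal simp_thms)
  then obtain \<B> where \<B>: "finite \<B>" "\<B> \<subseteq> ?\<A>"
    and ev: "eventually (\<lambda>x. x \<notin> S) (INF A\<in>\<B>. principal (S - A))"
    unfolding eventually_INF[where B = "?\<A>"] by blast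
  have cov: "S \<subseteq> \<Union>\<B>"
    using ev \<B>(1)
    by (auto simp: INF_principal_finite eventually_principal Ball_def split: if_splits)
  have "\<forall>A\<in>\<B>. \<exists>W. W \<in> \<U> \<and> ?N A \<subseteq> W"
    using \<B>(2) by blast
  from bchoice[OF this] obtain w where w: "\<And>A. A \<in> \<B> \<Longrightarrow> w A \<in> \<U> \<and> ?N A \<subseteq> w A"
    by blast
  have "U \<in> \<Union>(w ` \<B>)" if U: "U \<in> ultrafilters_on S" for U
  proof -
    have "eventually (\<lambda>x. \<exists>A\<in>\<B>. x \<in> A) U"
      using U cov by (auto simp: ultrafilters_on_def elim!: eventually_mono)
    moreover have "eventually (\<lambda>x. \<forall>A\<in>\<B>. x \<notin> A) U" if "\<forall>A\<in>\<B>. \<not> eventually (\<lambda>x. x \<in> A) U"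
      using that U \<B>(1) by (simp add: eventually_ball_finite ultrafilters_on_not)
    ultimately obtain A where "A \<in> \<B>" "eventually (\<lambda>x. x \<in> A) U"
      using ultrafilters_on_not[OF U, of "\<lambda>x. \<exists>A\<in>\<B>. x \<in> A"] by auto
    with U w show ?thesis by blast
  qed
  with \<B>(1) w show "\<exists>\<F>. finite \<F> \<and> \<F> \<subseteq> \<U> \<and> topspace (stone_cech S) \<subseteq> \<Union>\<F>"
    by (intro exI[of _ "w ` \<B>"]) auto
qed

lemma embedding_map_stone_cech:
  "embedding_map (discrete_topology S) (stone_cech S) (\<lambda>s. principal {s})"
proof -
  have "openin (stone_cech S) ((\<lambda>s. principal {s}) ` T)" if "T \<subseteq> S" for T
  proof -
    have "{U \<in> ultrafilters_on S. eventually (\<lambda>x. x = s) U} = {principal {s}}" if "s \<in> S" for s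
    proof (intro equalityI subsetI)
      fix U assume "U \<in> {U \<in> ultrafilters_on S. eventually (\<lambda>x. x = s) U}"
      then have U: "U \<in> ultrafilters_on S" "eventually (\<lambda>x. x = s) U" by auto
      have "eventually P U \<longleftrightarrow> P s" for P
      proof (cases "P s")
        case True
        then show ?thesis using U(2) by (auto elim: eventually_mono)
      next
        case False
        then have "eventually (\<lambda>x. \<not> P x) U" using U(2) by (auto elim: eventually_mono)
        then show ?thesis using False U(1) by (simp add: ultrafilters_on_not)
      qed
      then show "U \<in> {principal {s}}"
        by (simp add: filter_eq_iff eventually_principal)
    qed (use that in \<open>auto simp: principal_in_ultrafilters_on eventually_principal\<close>)
    then have "openin (stone_cech S) {principal {s}}" if "s \<in> S" for s
      using that openin_stone_cech_basic[of S "\<lambda>x. x = s"] by simp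
    then have "openin (stone_cech S) (\<Union>s\<in>T. {principal {s}})"
      using \<open>T \<subseteq> S\<close> by (intro openin_Union) auto
    then show ?thesis by (simp add: UNION_singleton_eq_range)
  qed
  then have "open_map (discrete_topology S) (stone_cech S) (\<lambda>s. principal {s})"
    by (simp add: open_map_def)
  then show ?thesis
    by (intro injective_open_imp_embedding_map)
       (auto simp: inj_on_def principal_in_ultrafilters_on)
qed

lemma dense_stone_cech:
  "stone_cech S closure_of ((\<lambda>s. principal {s}) ` S) = topspace (stone_cech S)"
proof -
  have "\<exists>y. y \<in> (\<lambda>s. principal {s}) ` S \<and> y \<in> W"
    if "U \<in> W" "openin (stone_cech S) W" for U W
  proof -
    from that obtain A where A: "A \<subseteq> S" "eventually (\<lambda>x. x \<in> A) U"
      and W: "\<And>V. V \<in> ultrafilters_on S \<Longrightarrow> eventually (\<lambda>x. x \<in> A) V \<Longrightarrow> V \<in> W"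
      using openin_stone_cech_nbhd by metis
    have "U \<noteq> bot"
      using that openin_subset[of "stone_cech S" W] by (auto simp: ultrafilters_on_def)
    with A(2) obtain s where "s \<in> A"
      by (metis eventually_happens')
    with A(1) have "principal {s} \<in> W"
      by (intro W) (auto simp: principal_in_ultrafilters_on eventually_principal)
    with A(1) \<open>s \<in> A\<close> show ?thesis by blast
  qed
  then show ?thesis
    by (auto simp: closure_of_def)
qed

lemma stone_cech_extension:
  assumes Y: "compact_space Y" "Hausdorff_space Y" and f: "f \<in> S \<rightarrow> topspace Y"
  obtains F where "continuous_map (stone_cech S) Y F" "\<And>s. s \<in> S \<Longrightarrow> F (principal {s}) = f s"
proof -
  have ex: "\<exists>y. limitin Y f y U" if U: "U \<in> ultrafilters_on S" for U
  proof (rule ccontr)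
    assume "\<nexists>y. limitin Y f y U"
    then have "\<forall>y\<in>topspace Y. \<exists>V. openin Y V \<and> y \<in> V \<and> \<not> eventually (\<lambda>x. f x \<in> V) U"
      by (auto simp: limitin_def)
    then obtain V where V: "\<And>y. y \<in> topspace Y \<Longrightarrow>
        openin Y (V y) \<and> y \<in> V y \<and> \<not> eventually (\<lambda>x. f x \<in> V y) U"
      by metis
    have "\<exists>\<F>. finite \<F> \<and> \<F> \<subseteq> V ` topspace Y \<and> topspace Y \<subseteq> \<Union>\<F>"
      using Y(1)[unfolded compact_space_alt, rule_format, of "V ` topspace Y"] V by blast
    then obtain T where T: "finite T" "T \<subseteq> topspace Y" "topspace Y \<subseteq> \<Union>(V ` T)"
      by (metis finite_subset_image)
    have "eventually (\<lambda>x. \<forall>y\<in>T. f x \<notin> V y) U"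
      using T V U by (intro eventually_ball_finite) (auto simp: ultrafilters_on_not)
    moreover have "eventually (\<lambda>x. x \<in> S) U"
      using U by (simp add: ultrafilters_on_def)
    ultimately have "eventually (\<lambda>x. False) U"
      by eventually_elim (use f T(3) in blast)
    with U show False
      by (simp add: ultrafilters_on_def eventually_False)
  qed
  define F where "F = (\<lambda>U. SOME y. limitin Y f y U)"
  have F: "limitin Y f (F U) U" if "U \<in> ultrafilters_on S" for U
    unfolding F_def using ex[OF that] by (rule someI_ex)
  have "F (principal {s}) = f s" if "s \<in> S" for s
  proof (rule limitin_Hausdorff_unique[OF _ _ _ Y(2)])
    show "limitin Y f (F (principal {s})) (principal {s})"
      by (rule F) (simp add: principal_in_ultrafilters_on that)
    show "limitin Y f (f s) (principal {s})"
      using that f by (auto simp: limitin_def eventually_principal)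
  qed (simp add: principal_eq_bot_iff)
  moreover have "continuous_map (stone_cech S) Y F"
    unfolding continuous_map_atin limitin_def
  proof (intro ballI conjI allI impI)
    fix U assume "U \<in> topspace (stone_cech S)"
    then have U: "U \<in> ultrafilters_on S" by simp
    show "F U \<in> topspace Y" using F[OF U] by (rule limitin_topspace)
    fix W assume W: "openin Y W \<and> F U \<in> W"
    have "neighbourhood_base_of (closedin Y) Y"
      using Y by (simp add: neighbourhood_base_of_closedin compact_Hausdorff_imp_regular_space)
    from this[unfolded neighbourhood_base_of, rule_format, OF W]
    obtain P C where OC: "openin Y P" "closedin Y C" "F U \<in> P" "P \<subseteq> C" "C \<subseteq> W"
      by blast
    let ?N = "{V \<in> ultrafilters_on S. eventually (\<lambda>x. f x \<in> P) V}"
    have "F V \<in> W" if "V \<in> ?N" for V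
    proof (rule ccontr)
      assume "F V \<notin> W"
      then have "F V \<in> topspace Y - C" using OC(5) that F[of V] by (auto simp: limitin_def)
      then have "eventually (\<lambda>x. f x \<in> topspace Y - C) V"
        using that OC(2) by (intro limitinD[OF F]) (auto simp: openin_diff)
      then have "eventually (\<lambda>x. f x \<notin> P) V"
        by eventually_elim (use OC in auto)
      with that show False by (auto simp: ultrafilters_on_not)
    qed
    moreover have "U \<in> ?N" using U F[OF U] OC by (auto simp: limitin_def)
    ultimately show "\<forall>\<^sub>F V in atin (stone_cech S) U. F V \<in> W"
      unfolding eventually_atin using openin_stone_cech_basic[of S "\<lambda>x. f x \<in> P"] by blast
  qed
  ultimately show thesis using that by blast
qed

lemma filtermap_eq_if_eventually_eq:
  assumes "eventually (\<lambda>x. f x = g x) F"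
  shows "filtermap f F = filtermap g F"
proof -
  have "eventually (\<lambda>x. P (f x) \<longleftrightarrow> P (g x)) F" for P
    using assms by eventually_elim simp
  then show ?thesis
    by (simp add: filter_eq_iff eventually_filtermap eventually_subst)
qed

lemma stone_cech_action:
  fixes G (structure)
  assumes "group G"
  shows "topological_action G (stone_cech (carrier G))
           (stone_cech_action G (topspace (stone_cech (carrier G))))"
    and "g \<in> carrier G \<Longrightarrow> h \<in> carrier G \<Longrightarrow>
           stone_cech_action G (topspace (stone_cech (carrier G))) g (principal {h}) =
           principal {g \<otimes> h}"
proof -
  interpret group G by fact
  let ?\<beta> = "ultrafilters_on (carrier G)"
  let ?\<phi> = "stone_cech_action G ?\<beta>"
  have mem: "filtermap (\<lambda>h. g \<otimes> h) U \<in> ?\<beta>" if "g \<in> carrier G" "U \<in> ?\<beta>" for g U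
  proof -
    have "eventually (\<lambda>h. g \<otimes> h \<in> carrier G) U"
      using that by (auto simp: ultrafilters_on_def elim: eventually_mono)
    then show ?thesis
      using that by (auto simp: ultrafilters_on_def eventually_filtermap filtermap_bot_iff)
  qed
  have comp: "filtermap (\<lambda>h. g \<otimes> h) (filtermap (\<lambda>h. k \<otimes> h) U) = filtermap (\<lambda>h. (g \<otimes> k) \<otimes> h) U"
    if "g \<in> carrier G" "k \<in> carrier G" "U \<in> ?\<beta>" for g k U
    unfolding filtermap_filtermap
    using that by (intro filtermap_eq_if_eventually_eq) (auto simp: ultrafilters_on_def m_assoc elim: eventually_mono)
  have one: "filtermap (\<lambda>h. \<one> \<otimes> h) U = U" if "U \<in> ?\<beta>" for U
  proof -
    have "filtermap (\<lambda>h. \<one> \<otimes> h) U = filtermap (\<lambda>h. h) U"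
      using that by (intro filtermap_eq_if_eventually_eq) (auto simp: ultrafilters_on_def elim: eventually_mono)
    then show ?thesis by (simp add: filtermap_ident)
  qed
  have inv: "filtermap (\<lambda>h. inv g \<otimes> h) (filtermap (\<lambda>h. g \<otimes> h) U) = U"
       "filtermap (\<lambda>h. g \<otimes> h) (filtermap (\<lambda>h. inv g \<otimes> h) U) = U"
    if "g \<in> carrier G" "U \<in> ?\<beta>" for g U
    using that by (simp_all add: comp one)
  have bij: "?\<phi> g \<in> Bij ?\<beta>" if "g \<in> carrier G" for g
  proof -
    have "bij_betw (?\<phi> g) ?\<beta> ?\<beta>"
      by (rule bij_betw_byWitness[where f' = "filtermap (\<lambda>h. inv g \<otimes> h)"])
         (use that in \<open>auto simp: stone_cech_action_def mem inv\<close>)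
    then show ?thesis by (simp add: Bij_def stone_cech_action_def)
  qed
  have act: "group_action G ?\<beta> ?\<phi>"
  proof (intro group_action.intro group_hom.intro group_hom_axioms.intro homI)
    fix g k assume "g \<in> carrier G" "k \<in> carrier G"
    then show "?\<phi> (g \<otimes> k) = ?\<phi> g \<otimes>\<^bsub>BijGroup ?\<beta>\<^esub> ?\<phi> k"
      by (auto simp: BijGroup_def bij compose_def fun_eq_iff)
         (auto simp: stone_cech_action_def mem comp)
  qed (use bij is_group group_BijGroup in \<open>auto simp: BijGroup_def\<close>)
  have cont: "continuous_map (stone_cech (carrier G)) (stone_cech (carrier G)) (?\<phi> g)"
    if g: "g \<in> carrier G" for g
    unfolding stone_cech_def[of "carrier G"] continuous_on_generated_topo_iff
  proof (fold stone_cech_def, intro conjI allI impI)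
    fix W assume "W \<in> (\<lambda>A. {U \<in> ?\<beta>. eventually (\<lambda>x. x \<in> A) U}) ` Pow (carrier G)"
    then obtain A where "W = {U \<in> ?\<beta>. eventually (\<lambda>x. x \<in> A) U}" by blast
    then have "?\<phi> g -` W \<inter> topspace (stone_cech (carrier G)) =
        {U \<in> ?\<beta>. eventually (\<lambda>h. g \<otimes> h \<in> A) U}"
      using g by (auto simp: stone_cech_action_def mem eventually_filtermap)
    then show "openin (stone_cech (carrier G)) (?\<phi> g -` W \<inter> topspace (stone_cech (carrier G)))"
      by (simp add: openin_stone_cech_basic)
  next
    show "?\<phi> g ` topspace (stone_cech (carrier G)) \<subseteq>
        \<Union>((\<lambda>A. {U \<in> ?\<beta>. eventually (\<lambda>x. x \<in> A) U}) ` Pow (carrier G))"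
      using g mem by (auto simp: stone_cech_action_def ultrafilters_on_def)
  qed
  have "homeomorphic_map (stone_cech (carrier G)) (stone_cech (carrier G)) (?\<phi> g)"
    if g: "g \<in> carrier G" for g
    using cont[OF g] bij[OF g]
    by (intro continuous_imp_homeomorphic_map compact_space_stone_cech Hausdorff_space_stone_cech)
       (auto simp: Bij_def bij_betw_def)
  with act show "topological_action G (stone_cech (carrier G))
      (stone_cech_action G (topspace (stone_cech (carrier G))))"
    by (simp add: topological_action_def)
  show "stone_cech_action G (topspace (stone_cech (carrier G))) g (principal {h}) =
      principal {g \<otimes> h}" if "g \<in> carrier G" "h \<in> carrier G"
    using that by (simp add: stone_cech_action_def principal_in_ultrafilters_on filtermap_principal)
qed

end

theory Submission
  imports Defs
begin

text \<open>
  Construction of the space. Choose a sequence \<open>s\<close> in \<open>G\<close> such that the products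
  \<open>s j\<^sub>1 \<cdots> s j\<^sub>n\<close> with \<open>j\<^sub>1 < \<cdots> < j\<^sub>n\<close> are pairwise distinct, let \<open>B n k\<close> be the set of those with
  \<open>k \<le> j\<^sub>1\<close>, and let \<open>X \<subseteq> \<beta>G\<close> be the union of all translates of the closures of the \<open>B n 0\<close>.
  The set \<open>B (n + 1) 0\<close> is the disjoint union of the translates \<open>s j B n (j + 1)\<close>, and
  \<open>B n k\<close> and \<open>B n (k + 1)\<close> differ by a translate of \<open>B (n - 1) (k + 1)\<close>. By induction on \<open>n\<close>, an
  invariant Radon measure therefore gives infinitely many disjoint subsets of the compact closure
  of \<open>B (n + 1) 0\<close> the mass of \<open>B n 0\<close>, so all these masses vanish.

  Cocompact actions. If \<open>A \<subseteq> G\<close> is not paradoxical, Hall's theorem provides Folner sets inside \<open>A\<close>,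
  and hence a finitely additive invariant mean on the sets covered by finitely many translates
  of \<open>A\<close>, normalised on \<open>A\<close>. For \<open>A = {g. g x \<in> L}\<close>, with \<open>L\<close> a compact neighbourhood of a set whose
  translates cover the space, pulling compact sets back along \<open>g \<mapsto> g x\<close> turns the mean into an
  invariant content, which extends to a non-zero invariant Radon measure.
\<close>

section \<open>Hall's theorem\<close>

text \<open>Halmos-Vaughan induction on \<open>card I\<close>. If a proper non-empty
  \<open>J\<close> has exactly \<open>card J\<close> neighbours, match \<open>J\<close> first and
  the remaining indices outside the neighbours of \<open>J\<close>. Otherwise every proper non-empty
  subfamily has a spare neighbour, so one index may take any \<open>x\<close> without breaking
  Hall's condition for the others.\<close>

lemma hall_finite:
  assumes "finite I" "\<And>i. i \<in> I \<Longrightarrow> finite (A i)"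
    and "\<And>J. J \<subseteq> I \<Longrightarrow> card J \<le> card (\<Union>(A ` J))"
  shows "\<exists>f. inj_on f I \<and> (\<forall>i\<in>I. f i \<in> A i)"
  using assms
proof (induction "card I" arbitrary: I A rule: less_induct)
  case less
  note fin = less.prems(1,2) and hall = less.prems(3)
  have strict: "card J < card (\<Union>(A ` J))" if "J \<subseteq> I" "card (\<Union>(A ` J)) \<noteq> card J" for J
    using hall[OF that(1)] that(2) by simp
  show ?case
  proof (cases "\<exists>J\<subseteq>I. J \<noteq> {} \<and> J \<noteq> I \<and> card (\<Union>(A ` J)) = card J")
    case True
    then obtain J where 2: "J \<subseteq> I" "J \<noteq> {}" "J \<noteq> I" "card (\<Union>(A ` J)) = card J"
      by blast
    let ?W = "\<Union>(A ` J)"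
    have finJ: "finite J" "finite ?W"
      using 2(1) fin by (auto intro: finite_subset)
    have "card J < card I"
      using 2 fin(1) by (metis psubsetI psubset_card_mono)
    then have "\<exists>f. inj_on f J \<and> (\<forall>i\<in>J. f i \<in> A i)"
    proof (rule less.hyps)
      show "finite (A i)" if "i \<in> J" for i
        using that 2(1) fin(2) by blast
      show "card L \<le> card (\<Union>(A ` L))" if "L \<subseteq> J" for L
        using that 2(1) by (intro hall) blast
    qed (rule finJ)
    then obtain f where f: "inj_on f J" "\<forall>i\<in>J. f i \<in> A i"
      by blast
    have "card (I - J) < card I"
      using 2 fin(1) by (intro psubset_card_mono) auto
    \<comment> \<open>Hall's condition for \<open>J \<union> L\<close>, minus the exactly
      \<open>card J\<close> neighbours in \<open>?W\<close>, is Hall's condition for the reduced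
      sets.\<close>
    moreover have "card L \<le> card (\<Union>((\<lambda>i. A i - ?W) ` L))" if L: "L \<subseteq> I - J" for L
    proof -
      have finL: "finite L" "finite (\<Union>(A ` L))"
        using L fin by (auto intro: finite_subset)
      have "card J + card L = card (J \<union> L)"
        using L finJ finL by (intro card_Un_disjoint[symmetric]) auto
      also have "\<dots> \<le> card (\<Union>(A ` (J \<union> L)))"
        using L 2(1) by (intro hall) auto
      also have "\<Union>(A ` (J \<union> L)) = ?W \<union> \<Union>((\<lambda>i. A i - ?W) ` L)"
        by auto
      also have "card \<dots> \<le> card ?W + card (\<Union>((\<lambda>i. A i - ?W) ` L))"
        by (rule card_Un_le)
      finally show ?thesis using 2(4) by simp
    qed
    ultimately have "\<exists>g. inj_on g (I - J) \<and> (\<forall>i\<in>I - J. g i \<in> A i - ?W)"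
      by (intro less.hyps[of "I - J" "\<lambda>i. A i - ?W"]) (use fin in simp_all)
    then obtain g where g: "inj_on g (I - J)" "\<forall>i\<in>I - J. g i \<in> A i - ?W"
      by blast
    have "inj_on (\<lambda>i. if i \<in> J then f i else g i) (J \<union> (I - J))"
    proof (rule inj_on_disjoint_Un[OF f(1) g(1)])
      have "f ` J \<subseteq> ?W" "g ` (I - J) \<subseteq> - ?W"
        using f(2) g(2) by auto
      then show "f ` J \<inter> g ` (I - J) = {}" by blast
    qed
    then have "inj_on (\<lambda>i. if i \<in> J then f i else g i) I"
      using 2(1) by (simp add: Un_absorb1)
    moreover have "\<forall>i\<in>I. (if i \<in> J then f i else g i) \<in> A i"
      using f g by auto
    ultimately show ?thesis by blast
  next
    case False
    have 3: "card J < card (\<Union>(A ` J))" if "J \<subseteq> I" "J \<noteq> {}" "J \<noteq> I" for J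
      by (rule strict) (use False that in auto)
    show ?thesis
    proof (cases "I = {}")
      case False
      then obtain i where i: "i \<in> I" by blast
      then have "A i \<noteq> {}"
        using hall[of "{i}"] by auto
      then obtain x where x: "x \<in> A i" by blast
      have "card (I - {i}) < card I"
        using i fin(1) by (meson card_Diff1_less)
      moreover have "card L \<le> card (\<Union>((\<lambda>j. A j - {x}) ` L))" if L: "L \<subseteq> I - {i}" for L
      proof (cases "L = {}")
        case False
        have "card L < card (\<Union>(A ` L))"
          using L False i by (intro 3) auto
        also have "\<dots> \<le> card (insert x (\<Union>((\<lambda>j. A j - {x}) ` L)))"
          using L fin by (intro card_mono) (auto intro: finite_subset)
        also have "\<dots> \<le> Suc (card (\<Union>((\<lambda>j. A j - {x}) ` L)))"
          by (rule card_insert_le_m1) auto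
        finally show ?thesis by simp
      qed simp
      ultimately have "\<exists>g. inj_on g (I - {i}) \<and> (\<forall>j\<in>I - {i}. g j \<in> A j - {x})"
        by (intro less.hyps[of "I - {i}" "\<lambda>j. A j - {x}"]) (use fin in simp_all)
      then obtain g where g: "inj_on g (I - {i})" "\<forall>j\<in>I - {i}. g j \<in> A j - {x}"
        by blast
      have "inj_on (g(i := x)) I"
        using g unfolding inj_on_def by (metis Diff_iff fun_upd_apply insert_iff empty_iff)
      moreover have "\<forall>j\<in>I. (g(i := x)) j \<in> A j"
        using g x by auto
      ultimately show ?thesis by blast
    qed simp
  qed
qed

text \<open>Ultrafilters are prime: if every value in \<open>B\<close> were avoided almost surely,
  then, \<open>B\<close> being finite, all of them would be avoided at once.\<close>

lemma ultrafilter_finite_choice: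
  assumes "U \<in> ultrafilters_on S" "finite B" "eventually (\<lambda>x. f x \<in> B) U"
  obtains b where "b \<in> B" "eventually (\<lambda>x. f x = b) U"
proof -
  have "\<exists>b\<in>B. eventually (\<lambda>x. f x = b) U"
  proof (rule ccontr)
    assume "\<not> ?thesis"
    then have "eventually (\<lambda>x. \<forall>b\<in>B. f x \<noteq> b) U"
      using assms by (intro eventually_ball_finite) (auto simp: ultrafilters_on_not)
    with assms(3) have "eventually (\<lambda>x. False) U"
      by eventually_elim auto
    with assms(1) show False
      by (simp add: ultrafilters_on_def eventually_False)
  qed
  with that show thesis by blast
qed

text \<open>Compactness by ultrafilters. The matchings \<open>f J\<close> of finite subfamilies take
  only finitely many values at a given \<open>i\<close>, so one value is attained for almost all
  \<open>J\<close>. Any two indices lie together in almost every \<open>J\<close>, which carries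
  injectivity to the limit.\<close>

lemma hall:
  assumes fin: "\<And>i. i \<in> I \<Longrightarrow> finite (A i)"
    and hall: "\<And>J. finite J \<Longrightarrow> J \<subseteq> I \<Longrightarrow> card J \<le> card (\<Union>(A ` J))"
  obtains f where "inj_on f I" "\<And>i. i \<in> I \<Longrightarrow> f i \<in> A i"
proof -
  have "\<exists>f. inj_on f J \<and> (\<forall>i\<in>J. f i \<in> A i)" if "finite J" "J \<subseteq> I" for J
  proof (rule hall_finite)
    show "finite (A i)" if "i \<in> J" for i
      using that \<open>J \<subseteq> I\<close> fin by blast
    show "card L \<le> card (\<Union>(A ` L))" if "L \<subseteq> J" for L
      using that \<open>finite J\<close> \<open>J \<subseteq> I\<close> by (intro hall) (auto intro: finite_subset)
  qed fact
  then obtain f where f: "\<And>J. finite J \<Longrightarrow> J \<subseteq> I \<Longrightarrow> inj_on (f J) J \<and> (\<forall>i\<in>J. f J i \<in> A i)"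
    by metis
  obtain U where U: "U \<in> ultrafilters_on UNIV" "U \<le> finite_subsets_at_top I"
    by (rule ultrafilter_exists[of "finite_subsets_at_top I" UNIV]) auto
  have ev: "eventually (\<lambda>J. finite J \<and> J \<subseteq> I \<and> K \<subseteq> J) U" if "finite K" "K \<subseteq> I" for K
    by (rule filter_leD[OF U(2)]) (use that in \<open>auto simp: eventually_finite_subsets_at_top\<close>)
  have "\<exists>a\<in>A i. eventually (\<lambda>J. f J i = a) U" if "i \<in> I" for i
  proof -
    have "eventually (\<lambda>J. f J i \<in> A i) U"
      by (rule eventually_mono[OF ev[of "{i}"]]) (use that f in auto)
    then show ?thesis
      using ultrafilter_finite_choice[OF U(1) fin[OF that]] by metis
  qed
  then obtain g where g: "\<And>i. i \<in> I \<Longrightarrow> g i \<in> A i \<and> eventually (\<lambda>J. f J i = g i) U"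
    by metis
  have "inj_on g I"
  proof (rule inj_onI, rule ccontr)
    fix i j assume ij: "i \<in> I" "j \<in> I" "g i = g j" "i \<noteq> j"
    have "eventually (\<lambda>J. f J i = g i) U"
      using g[OF ij(1)] by blast
    moreover have "eventually (\<lambda>J. f J j = g j) U"
      using g[OF ij(2)] by blast
    moreover have "eventually (\<lambda>J. finite J \<and> J \<subseteq> I \<and> {i, j} \<subseteq> J) U"
      by (rule ev) (use ij in auto)
    ultimately have "eventually (\<lambda>J. False) U"
    proof eventually_elim
      case (elim J)
      have "inj_on (f J) J"
        using f[of J] elim by blast
      moreover have "f J i = f J j"
        using elim ij(3) by metis
      ultimately have "i = j"
        by (rule inj_onD) (use elim in auto)
      with ij(4) show False by contradiction
    qed
    with U(1) show False
      by (simp add: ultrafilters_on_def eventually_False)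
  qed
  with g that show thesis by blast
qed

section \<open>Folner sets and means for non-paradoxical sets\<close>

text \<open>The product set \<open>S F\<close> is cut down to \<open>A\<close> because the pieces of
  a paradoxical decomposition must lie in \<open>A\<close>: only growth inside \<open>A\<close>
  counts.\<close>

definition inner_nbhd ::
    "('g, 'm) monoid_scheme \<Rightarrow> 'g set \<Rightarrow> 'g set \<Rightarrow> 'g set \<Rightarrow> 'g set" where
  "inner_nbhd G A S F = {b \<in> A. \<exists>s\<in>S. \<exists>a\<in>F. b = s \<otimes>\<^bsub>G\<^esub> a}"

lemma finite_inner_nbhd: "finite S \<Longrightarrow> finite F \<Longrightarrow> finite (inner_nbhd G A S F)"
proof -
  assume "finite S" "finite F"
  then have "finite ((\<lambda>(s, a). s \<otimes>\<^bsub>G\<^esub> a) ` (S \<times> F))"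
    by simp
  then show ?thesis
    by (rule finite_subset[rotated]) (auto simp: inner_nbhd_def)
qed

text \<open>Hall's theorem for two copies of \<open>A\<close> gives an injection \<open>f\<close> of
  \<open>A \<times> bool\<close> into \<open>A\<close> that moves each point by some element of
  \<open>S\<close>. Sorting its values by copy and by translating element yields disjoint pieces;
  translating them back recovers \<open>A\<close> once from each copy.\<close>

lemma paradoxical_if_doubling:
  fixes G (structure)
  assumes "group G" "A \<subseteq> carrier G" "A \<noteq> {}" "finite S" "S \<subseteq> carrier G"
    and doubling: "\<And>F. finite F \<Longrightarrow> F \<subseteq> A \<Longrightarrow> 2 * card F \<le> card (inner_nbhd G A S F)"
  shows "paradoxical G A"
proof -
  interpret group G by fact
  define Q where "Q p = inner_nbhd G A S {fst p}" for p :: "'a \<times> bool"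
  obtain f where f: "inj_on f (A \<times> UNIV)" "\<And>p. p \<in> A \<times> UNIV \<Longrightarrow> f p \<in> Q p"
  proof (rule hall[of "A \<times> UNIV" Q])
    show "finite (Q p)" for p
      using \<open>finite S\<close> by (auto simp: Q_def finite_inner_nbhd)
    fix J :: "('a \<times> bool) set" assume J: "finite J" "J \<subseteq> A \<times> UNIV"
    \<comment> \<open>\<open>J\<close> lies inside both full copies of its projection, and the
      doubling hypothesis bounds exactly those.\<close>
    have "card J \<le> card (fst ` J \<times> (UNIV :: bool set))"
      using J by (intro card_mono) force+
    also have "\<dots> = 2 * card (fst ` J)"
      by (simp add: card_cartesian_product)
    also have "\<dots> \<le> card (inner_nbhd G A S (fst ` J))"
      using J by (intro doubling) auto
    also have "inner_nbhd G A S (fst ` J) = \<Union>(Q ` J)"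
      unfolding inner_nbhd_def Q_def by blast
    finally show "card J \<le> card (\<Union>(Q ` J))" .
  qed blast
  obtain h where h: "bij_betw h {0..<card S} S"
    using ex_bij_betw_nat_finite[OF \<open>finite S\<close>] by blast
  define n where "n = card S"
  \<comment> \<open>Both index ranges \<open>1..n\<close> and \<open>n+1..n+n\<close> run through
    all of \<open>S\<close>; the test \<open>k \<le> n\<close> tells which copy of \<open>A\<close>
    an index belongs to. The enumeration \<open>h\<close> starts at 0, hence the subtraction of
    1.\<close>
  define s where "s k = h (if k \<le> n then k - 1 else k - n - 1)" for k
  define V where "V k = {f (a, k \<le> n) | a. a \<in> A \<and> f (a, k \<le> n) = s k \<otimes> a}" for k
  have fQ: "\<exists>s\<in>S. f (a, i) = s \<otimes> a" "f (a, i) \<in> A" if "a \<in> A" for a i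
    using f(2)[of "(a, i)"] that by (auto simp: Q_def inner_nbhd_def)
  have s: "s k \<in> carrier G" if "k \<in> {1..n+n}" for k
  proof -
    have "(if k \<le> n then k - 1 else k - n - 1) \<in> {0..<card S}"
      using that by (auto simp: n_def)
    then show ?thesis
      unfolding s_def using bij_betw_apply[OF h] \<open>S \<subseteq> carrier G\<close> by blast
  qed
  have cover: "(\<Union>k\<in>K. inv (s k) <# V k) = A"
    if K: "K \<subseteq> {1..n+n}" and KS: "s ` K = S" and Ki: "\<And>k. k \<in> K \<Longrightarrow> (k \<le> n) = i" for K i
  proof (intro equalityI subsetI)
    fix x assume "x \<in> (\<Union>k\<in>K. inv (s k) <# V k)"
    then obtain k a where k: "k \<in> K" and a: "a \<in> A" "x = inv (s k) \<otimes> (s k \<otimes> a)"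
      by (auto simp: l_coset_def V_def)
    have "s k \<in> carrier G" "a \<in> carrier G"
      using s k(1) K a(1) assms(2) by blast+
    then have "x = a"
      by (simp add: a(2) m_assoc[symmetric])
    with a show "x \<in> A" by simp
  next
    fix a assume a: "a \<in> A"
    obtain r where r: "r \<in> S" "f (a, i) = r \<otimes> a"
      using fQ(1)[OF a, of i] by blast
    then obtain k where "k \<in> K" "r = s k"
      unfolding KS[symmetric] by blast
    with r have k: "k \<in> K" "f (a, i) = s k \<otimes> a"
      by simp_all
    have *: "f (a, k \<le> n) = s k \<otimes> a"
      using k(2) by (simp add: Ki[OF k(1)])
    then have "f (a, k \<le> n) \<in> V k"
      unfolding V_def using a by blast
    then have "s k \<otimes> a \<in> V k"
      by (simp only: *)
    moreover have "a = inv (s k) \<otimes> (s k \<otimes> a)"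
    proof -
      have "s k \<in> carrier G" "a \<in> carrier G"
        using s k(1) K a assms(2) by blast+
      then show ?thesis
        by (simp add: m_assoc[symmetric])
    qed
    ultimately show "a \<in> (\<Union>k\<in>K. inv (s k) <# V k)"
      using k(1) unfolding l_coset_def by blast
  qed
  have im1: "s ` {1..n} = S"
  proof -
    have "s ` {1..n} = h ` ((\<lambda>k. k - 1) ` {1..n})"
      unfolding s_def by (auto simp: image_image)
    also have "(\<lambda>k. k - 1) ` {1..n} = {0..<card S}"
      unfolding n_def by (auto simp: image_iff intro!: bexI[of _ "Suc _"])
    finally show ?thesis using h by (simp add: bij_betw_def)
  qed
  have im2: "s ` {n+1..n+n} = S"
  proof -
    have "s ` {n+1..n+n} = h ` ((\<lambda>k. k - n - 1) ` {n+1..n+n})"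
      unfolding s_def by (auto simp: image_image)
    also have "(\<lambda>k. k - n - 1) ` {n+1..n+n} = {0..<card S}"
      unfolding n_def by (auto simp: image_iff intro!: bexI[of _ "card S + Suc _"])
    finally show ?thesis using h by (simp add: bij_betw_def)
  qed
  \<comment> \<open>A common value of two pieces determines the point and the copy, since
    \<open>f\<close> is injective; cancelling the point then determines the translating element,
    hence the index.\<close>
  have disj: "disjoint_family_on V {1..n+n}"
    unfolding disjoint_family_on_def
  proof (intro ballI impI, rule ccontr)
    fix k l assume kl: "k \<in> {1..n+n}" "l \<in> {1..n+n}" "k \<noteq> l" "V k \<inter> V l \<noteq> {}"
    then obtain x where "x \<in> V k" "x \<in> V l" by blast
    then obtain a b where ab: "a \<in> A" "x = f (a, k \<le> n)" "f (a, k \<le> n) = s k \<otimes> a"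
      "b \<in> A" "x = f (b, l \<le> n)" "f (b, l \<le> n) = s l \<otimes> b"
      unfolding V_def by blast
    have "(a, k \<le> n) = (b, l \<le> n)"
      by (rule inj_onD[OF f(1)]) (use ab in simp_all)
    then have eq: "a = b" "(k \<le> n) = (l \<le> n)" by auto
    have "s k \<otimes> a = s l \<otimes> a" using ab eq by metis
    moreover have "a \<in> carrier G" using ab(1) assms(2) by blast
    ultimately have "s k = s l"
      using s[OF kl(1)] s[OF kl(2)] by simp
    then have "(if k \<le> n then k - 1 else k - n - 1) = (if l \<le> n then l - 1 else l - n - 1)"
      unfolding s_def by (rule inj_onD[OF bij_betw_imp_inj_on[OF h]]) (use kl in \<open>auto simp: n_def\<close>)
    with eq(2) kl show False by (auto split: if_splits)
  qed
  have "\<forall>k\<in>{1..n+n}. V k \<subseteq> A \<and> inv (s k) \<in> carrier G"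
    using fQ(2) s by (auto simp: V_def)
  moreover have "(\<Union>k\<in>{1..n}. inv (s k) <# V k) = A"
    by (rule cover[OF _ im1, of True]) auto
  moreover have "(\<Union>k\<in>{n+1..n+n}. inv (s k) <# V k) = A"
    by (rule cover[OF _ im2, of False]) auto
  ultimately show ?thesis
    unfolding paradoxical_def using assms(2,3) disj
    by (intro conjI exI[of _ n] exI[of _ V] exI[of _ "\<lambda>k. inv (s k)"]) auto
qed

text \<open>Associativity gives the inclusion. Equality may fail, because on the left the
  intermediate point has to lie in \<open>A\<close> as well.\<close>

lemma inner_nbhd_iterate:
  fixes G (structure)
  assumes "group G" "A \<subseteq> carrier G" "F \<subseteq> A" "S \<subseteq> carrier G" "S' \<subseteq> carrier G"
  shows "inner_nbhd G A S (inner_nbhd G A S' F) \<subseteq> inner_nbhd G A (S <#>\<^bsub>G\<^esub> S') F"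
proof
  interpret group G by fact
  fix b assume "b \<in> inner_nbhd G A S (inner_nbhd G A S' F)"
  then obtain s s' a where *: "b \<in> A" "s \<in> S" "s' \<in> S'" "a \<in> F" "b = s \<otimes>\<^bsub>G\<^esub> (s' \<otimes>\<^bsub>G\<^esub> a)"
    by (auto simp: inner_nbhd_def)
  then have "b = (s \<otimes>\<^bsub>G\<^esub> s') \<otimes>\<^bsub>G\<^esub> a"
    using assms by (metis m_assoc subsetD)
  with * show "b \<in> inner_nbhd G A (S <#>\<^bsub>G\<^esub> S') F"
    unfolding inner_nbhd_def set_mult_def by blast
qed

text \<open>If every finite set grew by the factor \<open>1 + \<epsilon>\<close> under \<open>S\<close>, then it would double under some
  power of \<open>S\<close>.\<close>

lemma folner_sets:
  fixes G (structure)
  assumes "group G" "A \<subseteq> carrier G" "A \<noteq> {}" "\<not> paradoxical G A"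
    and S: "finite S" "S \<subseteq> carrier G" and \<epsilon>: "0 < (\<epsilon>::real)"
  obtains F where "finite F" "F \<noteq> {}" "F \<subseteq> A"
    "real (card (inner_nbhd G A S F)) < (1 + \<epsilon>) * real (card F)"
proof -
  interpret group G by fact
  have "\<exists>F. finite F \<and> F \<noteq> {} \<and> F \<subseteq> A \<and>
      real (card (inner_nbhd G A S F)) < (1 + \<epsilon>) * real (card F)"
  proof (rule ccontr)
    assume "\<not> ?thesis"
    then have grow: "(1 + \<epsilon>) * real (card F) \<le> real (card (inner_nbhd G A S F))"
      if "finite F" "F \<subseteq> A" for F
      using that by (cases "F = {}") (auto simp: not_less)
    \<comment> \<open>\<open>T k\<close> is the \<open>k\<close>-fold product set of
      \<open>S\<close>, with \<open>T 0\<close> the trivial set \<open>{\<one>}\<close>.\<close>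
    define T where "T k = ((\<lambda>S'. S <#> S') ^^ k) {\<one>}" for k :: nat
    have T: "finite (T k) \<and> T k \<subseteq> carrier G" for k
    proof (induction k)
      case (Suc k)
      have "S <#> T k = (\<lambda>(s, t). s \<otimes> t) ` (S \<times> T k)"
        by (auto simp: set_mult_def)
      with Suc S set_mult_closed[of S "T k"] show ?case
        by (simp add: T_def)
    qed (simp add: T_def)
    have pow: "(1 + \<epsilon>) ^ k * real (card F) \<le> real (card (inner_nbhd G A (T k) F))"
      if "finite F" "F \<subseteq> A" for F k
    proof (induction k)
      case 0
      have "F \<subseteq> inner_nbhd G A (T 0) F"
        using that assms(2) by (force simp: inner_nbhd_def T_def)
      then show ?case
        using that by (simp add: card_mono finite_inner_nbhd T)
    next
      case (Suc k)
      let ?N = "inner_nbhd G A (T k) F"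
      have "(1 + \<epsilon>) ^ Suc k * real (card F) \<le> (1 + \<epsilon>) * real (card ?N)"
        using Suc \<epsilon> by (simp add: mult.assoc)
      also have "\<dots> \<le> real (card (inner_nbhd G A S ?N))"
        by (rule grow) (use that T in \<open>simp_all add: finite_inner_nbhd inner_nbhd_def\<close>)
      also have "\<dots> \<le> real (card (inner_nbhd G A (T (Suc k)) F))"
        using inner_nbhd_iterate[OF assms(1,2) that(2) S(2), of "T k"] T[of k] T[of "Suc k"] that(1)
        by (simp add: card_mono finite_inner_nbhd T_def)
      finally show ?case .
    qed
    obtain k where k: "2 < (1 + \<epsilon>) ^ k"
      using real_arch_pow[of "1 + \<epsilon>" 2] \<epsilon> by auto
    have "2 * card F \<le> card (inner_nbhd G A (T k) F)" if "finite F" "F \<subseteq> A" for F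
    proof -
      have "2 * real (card F) \<le> (1 + \<epsilon>) ^ k * real (card F)"
        using k by (intro mult_right_mono) auto
      with pow[OF that, of k] show ?thesis by linarith
    qed
    then have "paradoxical G A"
      using paradoxical_if_doubling[OF assms(1-3)] T by blast
    with assms(4) show False by contradiction
  qed
  with that show thesis by blast
qed

section \<open>Ultralimits and the invariant mean\<close>

lemma ultrafilter_tendsto:
  fixes f :: "'a \<Rightarrow> 'b::{t2_space}"
  assumes U: "U \<in> ultrafilters_on S" and "compact (UNIV :: 'b set)"
  shows "(f \<longlongrightarrow> Lim U f) U"
proof -
  have "U \<noteq> bot" using U by (simp add: ultrafilters_on_def)
  then have "filtermap f U \<noteq> bot" by (simp add: filtermap_bot_iff)
  \<comment> \<open>Compactness provides a cluster point. It is a limit: if a neighbourhood of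
    \<open>l\<close> were not attained almost surely, its complement would be, by the ultrafilter
    property.\<close>
  then obtain l where l: "inf (nhds l) (filtermap f U) \<noteq> bot"
    using assms(2) unfolding compact_filter by auto
  have "(f \<longlongrightarrow> l) U"
  proof (rule topological_tendstoI, rule ccontr)
    fix W assume W: "open W" "l \<in> W" "\<not> eventually (\<lambda>x. f x \<in> W) U"
    then have "eventually (\<lambda>y. y \<notin> W) (filtermap f U)"
      using U by (simp add: eventually_filtermap ultrafilters_on_not)
    moreover have "eventually (\<lambda>y. y \<in> W) (nhds l)"
      using W by (auto simp: eventually_nhds)
    ultimately have "eventually (\<lambda>y. False) (inf (nhds l) (filtermap f U))"
      unfolding eventually_inf by blast
    with l show False by (simp add: eventually_False)
  qed
  then show ?thesis
    using tendsto_Lim[OF \<open>U \<noteq> bot\<close>] by metis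
qed

text \<open>The mean is an ultralimit of the counting measures on \<open>S n F n\<close>, normalised by \<open>card (F n)\<close>,
  where \<open>F n\<close> is a Folner set in \<open>A\<close> for \<open>(S n)\<inverse> S n\<close>. Counting on \<open>S n F n\<close> rather than on
  \<open>F n \<subseteq> A\<close> makes the mean invariant on every translate of \<open>A\<close> and not only inside \<open>A\<close>.\<close>

lemma invariant_mean:
  fixes G (structure)
  assumes "group G" "countable (carrier G)" "A \<subseteq> carrier G" "A \<noteq> {}" "\<not> paradoxical G A"
  obtains m :: "'a set \<Rightarrow> ennreal" where
    "m A = 1"
    "\<And>B C. B \<inter> C = {} \<Longrightarrow> m (B \<union> C) = m B + m C"
    "\<And>B g s. g \<in> carrier G \<Longrightarrow> s \<in> carrier G \<Longrightarrow> B \<subseteq> (\<lambda>x. s \<otimes> x) ` A \<Longrightarrow>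
       m ((\<lambda>x. g \<otimes> x) ` B) = m B"
proof -
  interpret group G by fact
  define e where "e = from_nat_into (carrier G)"
  have e: "range e = carrier G"
    unfolding e_def by (rule range_from_nat_into) (use assms in auto)
  define S where "S n = e ` {..n}" for n :: nat
  have S: "finite (S n)" "S n \<subseteq> carrier G" "S n \<noteq> {}" for n
    using e by (auto simp: S_def)
  \<comment> \<open>\<open>T n\<close> collects the quotients that arise when a point of
    \<open>s F\<close> also lies in \<open>t F\<close>, for \<open>s\<close> and \<open>t\<close> in
    \<open>S n\<close>.\<close>
  define T where "T n = (\<lambda>(s, t). inv s \<otimes> t) ` (S n \<times> S n)" for n :: nat
  have T: "finite (T n)" "T n \<subseteq> carrier G" for n
    using S[of n] by (auto simp: T_def)
  have T_mem: "inv s \<otimes> t \<in> T n" if "s \<in> S n" "t \<in> S n" for s t n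
    unfolding T_def by (rule image_eqI[of _ _ "(s, t)"]) (use that in auto)
  have "\<exists>F. finite F \<and> F \<noteq> {} \<and> F \<subseteq> A \<and>
      real (card (inner_nbhd G A (T n) F)) < (1 + 1 / real (Suc n)) * real (card F)" for n
    using folner_sets[OF assms(1,3,4,5) T[of n], of "1 / real (Suc n)"] by (metis zero_less_divide_1_iff of_nat_0_less_iff zero_less_Suc)
  then obtain F where F: "\<And>n. finite (F n)" "\<And>n. F n \<noteq> {}" "\<And>n. F n \<subseteq> A"
    "\<And>n. real (card (inner_nbhd G A (T n) (F n))) < (1 + 1 / real (Suc n)) * real (card (F n))"
    by metis
  define W where "W n = (\<lambda>(s, a). s \<otimes> a) ` (S n \<times> F n)" for n
  have finW: "finite (W n)" for n
    using S(1) F(1) by (simp add: W_def)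
  have cardF: "0 < card (F n)" for n
    using F(1,2) by (simp add: card_gt_0_iff)
  define \<nu> where "\<nu> n B = real (card (B \<inter> W n)) / real (card (F n))" for n B
  define d where "d n D = real (card (D \<inter> F n)) / real (card (F n))" for n D
  \<comment> \<open>Translating by \<open>s\<close> sends \<open>D \<inter> F n\<close> into
    \<open>W n\<close>. Conversely, if \<open>s x = t a\<close> with \<open>a\<close> in
    \<open>F n\<close>, then \<open>x\<close> is \<open>inv s \<otimes> t\<close> applied to
    \<open>a\<close> and lies in the inner neighbourhood \<open>?N\<close>. The excess is thus at
    most the size of \<open>?N - F n\<close>, which the Folner condition makes small.\<close>
  have bounds: "d n D \<le> \<nu> n ((\<lambda>x. s \<otimes> x) ` D) \<and> \<nu> n ((\<lambda>x. s \<otimes> x) ` D) \<le> d n D + 1 / real (Suc n)"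
    if s: "s \<in> S n" and D: "D \<subseteq> A" for n s D
  proof -
    let ?N = "inner_nbhd G A (T n) (F n)"
    have sG: "s \<in> carrier G" using s S(2) by blast
    have DG: "D \<subseteq> carrier G" using D assms(3) by blast
    have inj: "inj_on (\<lambda>x. s \<otimes> x) D"
      by (rule inj_on_subset[OF inj_on_cmult[OF sG] DG])
    have finN: "finite ?N" using T(1) F(1) by (rule finite_inner_nbhd)
    have FN: "F n \<subseteq> ?N"
    proof
      fix a assume a: "a \<in> F n"
      then have aG: "a \<in> carrier G" using F(3) assms(3) by blast
      have "inv s \<otimes> s \<in> T n" using T_mem[OF s s] .
      moreover have "a = (inv s \<otimes> s) \<otimes> a" using sG aG by simp
      ultimately show "a \<in> ?N" unfolding inner_nbhd_def using a F(3) by blast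
    qed
    have "(\<lambda>x. s \<otimes> x) ` (D \<inter> F n) \<subseteq> (\<lambda>x. s \<otimes> x) ` D \<inter> W n"
      using s by (auto simp: W_def)
    then have "card ((\<lambda>x. s \<otimes> x) ` (D \<inter> F n)) \<le> card ((\<lambda>x. s \<otimes> x) ` D \<inter> W n)"
      using finW by (intro card_mono) auto
    moreover have "card ((\<lambda>x. s \<otimes> x) ` (D \<inter> F n)) = card (D \<inter> F n)"
      using inj by (intro card_image) (auto intro: inj_on_subset)
    ultimately have 1: "card (D \<inter> F n) \<le> card ((\<lambda>x. s \<otimes> x) ` D \<inter> W n)" by simp
    have "(\<lambda>x. s \<otimes> x) ` D \<inter> W n \<subseteq> (\<lambda>x. s \<otimes> x) ` (D \<inter> ?N)"
    proof
      fix y assume "y \<in> (\<lambda>x. s \<otimes> x) ` D \<inter> W n"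
      then obtain x t a where x: "x \<in> D" "y = s \<otimes> x" and ta: "t \<in> S n" "a \<in> F n" "y = t \<otimes> a"
        by (auto simp: W_def)
      have G: "x \<in> carrier G" "t \<in> carrier G" "a \<in> carrier G"
        using x(1) DG ta S(2) F(3) assms(3) by blast+
      have "x = inv s \<otimes> (t \<otimes> a)"
        using x(2) ta(3) sG G by (metis inv_solve_left m_closed)
      then have "x = (inv s \<otimes> t) \<otimes> a"
        using sG G by (simp add: m_assoc)
      moreover have "inv s \<otimes> t \<in> T n" using T_mem[OF s ta(1)] .
      ultimately have "x \<in> ?N" using x(1) D ta(2) unfolding inner_nbhd_def by blast
      with x show "y \<in> (\<lambda>x. s \<otimes> x) ` (D \<inter> ?N)" by blast
    qed
    then have "card ((\<lambda>x. s \<otimes> x) ` D \<inter> W n) \<le> card ((\<lambda>x. s \<otimes> x) ` (D \<inter> ?N))"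
      using finN by (intro card_mono) auto
    also have "\<dots> \<le> card (D \<inter> ?N)"
      using finN by (intro card_image_le) auto
    also have "\<dots> \<le> card ((D \<inter> F n) \<union> (?N - F n))"
      using finN F(1) by (intro card_mono) auto
    also have "\<dots> \<le> card (D \<inter> F n) + card (?N - F n)"
      by (rule card_Un_le)
    also have "card (?N - F n) = card ?N - card (F n)"
      using F(1) FN by (rule card_Diff_subset)
    finally have "card ((\<lambda>x. s \<otimes> x) ` D \<inter> W n) \<le> card (D \<inter> F n) + (card ?N - card (F n))" .
    moreover have "card (F n) \<le> card ?N"
      using finN FN by (rule card_mono)
    ultimately have "real (card ((\<lambda>x. s \<otimes> x) ` D \<inter> W n)) \<le>
        real (card (D \<inter> F n)) + (real (card ?N) - real (card (F n)))"
      by linarith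
    also have "\<dots> \<le> real (card (D \<inter> F n)) + 1 / real (Suc n) * real (card (F n))"
      using F(4)[of n] by (simp add: algebra_simps)
    finally show ?thesis
      using 1 cardF[of n] by (simp add: \<nu>_def d_def divide_simps)
  qed
  obtain U :: "nat filter" where U: "U \<in> ultrafilters_on UNIV" "U \<le> sequentially"
    by (rule ultrafilter_exists[of sequentially UNIV]) auto
  have Ubot: "U \<noteq> bot" using U(1) by (simp add: ultrafilters_on_def)
  \<comment> \<open>The type \<open>ennreal\<close> is compact, so the ultralimit exists for every
    set, even where the densities are unbounded.\<close>
  define m where "m B = Lim U (\<lambda>n. ennreal (\<nu> n B))" for B
  define m0 where "m0 D = Lim U (\<lambda>n. ennreal (d n D))" for D
  have m: "((\<lambda>n. ennreal (\<nu> n B)) \<longlongrightarrow> m B) U" for B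
    unfolding m_def by (rule ultrafilter_tendsto[OF U(1) compact_UNIV])
  have m0: "((\<lambda>n. ennreal (d n D)) \<longlongrightarrow> m0 D) U" for D
    unfolding m0_def by (rule ultrafilter_tendsto[OF U(1) compact_UNIV])
  \<comment> \<open>Each fixed \<open>s\<close> belongs to \<open>S n\<close> from some
    \<open>n\<close> on, so \<open>bounds\<close> squeezes the mean of \<open>s D\<close> to
    \<open>m0 D\<close>. This value does not involve \<open>s\<close>, which is the
    invariance.\<close>
  have translate: "m ((\<lambda>x. s \<otimes> x) ` D) = m0 D" if s: "s \<in> carrier G" and D: "D \<subseteq> A" for s D
  proof -
    obtain k where k: "s = e k" using s e by blast
    have ev: "eventually (\<lambda>n. s \<in> S n) U"
      by (rule filter_leD[OF U(2) eventually_sequentiallyI[of k]]) (auto simp: S_def k)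
    have "((\<lambda>n. 1 / real (Suc n)) \<longlongrightarrow> 0) U"
      using LIMSEQ_inverse_real_of_nat U(2) by (simp add: tendsto_mono inverse_eq_divide)
    then have "((\<lambda>n. ennreal (d n D) + ennreal (1 / real (Suc n))) \<longlongrightarrow> m0 D + ennreal 0) U"
      by (intro tendsto_add m0 tendsto_ennrealI)
    then have up: "((\<lambda>n. ennreal (d n D) + ennreal (1 / real (Suc n))) \<longlongrightarrow> m0 D) U"
      by simp
    have "((\<lambda>n. ennreal (\<nu> n ((\<lambda>x. s \<otimes> x) ` D))) \<longlongrightarrow> m0 D) U"
    proof (rule tendsto_sandwich[OF _ _ m0 up])
      show "eventually (\<lambda>n. ennreal (d n D) \<le> ennreal (\<nu> n ((\<lambda>x. s \<otimes> x) ` D))) U"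
        by (rule eventually_mono[OF ev]) (use bounds D in \<open>auto intro: ennreal_leI\<close>)
      have upper: "ennreal (\<nu> n ((\<lambda>x. s \<otimes> x) ` D)) \<le> ennreal (d n D) + ennreal (1 / real (Suc n))"
        if "s \<in> S n" for n
      proof -
        have "ennreal (\<nu> n ((\<lambda>x. s \<otimes> x) ` D)) \<le> ennreal (d n D + 1 / real (Suc n))"
          using bounds[OF that D] by (intro ennreal_leI) auto
        also have "\<dots> = ennreal (d n D) + ennreal (1 / real (Suc n))"
          by (rule ennreal_plus) (auto simp: d_def)
        finally show ?thesis .
      qed
      show "eventually (\<lambda>n. ennreal (\<nu> n ((\<lambda>x. s \<otimes> x) ` D)) \<le>
          ennreal (d n D) + ennreal (1 / real (Suc n))) U"
        by (rule eventually_mono[OF ev upper])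
    qed
    then show ?thesis
      by (rule tendsto_unique[OF Ubot m])
  qed
  show thesis
  proof
    have "d n A = 1" for n
      using F(3) cardF by (simp add: d_def Int_absorb1)
    then have "m0 A = 1"
      using tendsto_unique[OF Ubot m0[of A], of 1] by simp
    moreover have "(\<lambda>x. \<one> \<otimes> x) ` A = A"
      using assms(3) by (force simp: image_iff)
    ultimately show "m A = 1"
      using translate[of \<one> A] by simp
  next
    fix B C :: "'a set" assume BC: "B \<inter> C = {}"
    have "\<nu> n (B \<union> C) = \<nu> n B + \<nu> n C" for n
    proof -
      have "card ((B \<union> C) \<inter> W n) = card ((B \<inter> W n) \<union> (C \<inter> W n))"
        by (simp add: Int_Un_distrib2)
      also have "\<dots> = card (B \<inter> W n) + card (C \<inter> W n)"
        using finW BC by (intro card_Un_disjoint) auto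
      finally show ?thesis
        by (simp add: \<nu>_def add_divide_distrib)
    qed
    then have "ennreal (\<nu> n (B \<union> C)) = ennreal (\<nu> n B) + ennreal (\<nu> n C)" for n
      by (simp add: \<nu>_def)
    then show "m (B \<union> C) = m B + m C"
      using tendsto_unique[OF Ubot m[of "B \<union> C"] , of "m B + m C"] tendsto_add[OF m[of B] m[of C]]
      by simp
  next
    fix B g s assume g: "g \<in> carrier G" and s: "s \<in> carrier G" and B: "B \<subseteq> (\<lambda>x. s \<otimes> x) ` A"
    obtain D where D: "D \<subseteq> A" "B = (\<lambda>x. s \<otimes> x) ` D"
      using B by (meson subset_imageE)
    have "(\<lambda>x. g \<otimes> x) ` B = (\<lambda>x. (g \<otimes> s) \<otimes> x) ` D"
      unfolding D(2) image_image
      by (rule image_cong[OF refl]) (use D(1) assms(3) g s in \<open>auto simp: m_assoc\<close>)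
    then have "m ((\<lambda>x. g \<otimes> x) ` B) = m0 D"
      using translate[of "g \<otimes> s" D] g s D(1) by simp
    also have "\<dots> = m B"
      using translate[of s D] s D by simp
    finally show "m ((\<lambda>x. g \<otimes> x) ` B) = m B" .
  qed
qed

section \<open>Radon measures from contents\<close>

text \<open>The compact sets \<open>K - U\<close> and \<open>K - V\<close> are disjoint, so they
  have disjoint open neighbourhoods \<open>P\<close> and \<open>Q\<close>; the two parts are
  \<open>K - P\<close> and \<open>K - Q\<close>.\<close>

lemma compactin_split:
  assumes "Hausdorff_space X" "compactin X K" "openin X U" "openin X V" "K \<subseteq> U \<union> V"
  obtains A B where "compactin X A" "compactin X B" "A \<subseteq> U" "B \<subseteq> V" "K = A \<union> B"
proof -
  have sub: "compactin X (K - W)" if "openin X W" for W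
  proof -
    have "closedin X (K - W)"
      using compactin_imp_closedin[OF assms(1,2)] that by (rule closedin_diff)
    then show ?thesis
      using closed_compactin[OF assms(2)] by (metis Diff_subset)
  qed
  have "disjnt (K - U) (K - V)"
    using assms(5) unfolding disjnt_def by blast
  then obtain P Q where PQ: "openin X P" "openin X Q" "K - U \<subseteq> P" "K - V \<subseteq> Q" "disjnt P Q"
    by (rule Hausdorff_space_compact_separation[OF assms(1) sub[OF assms(3)] sub[OF assms(4)]])
  show thesis
  proof
    show "compactin X (K - P)" "compactin X (K - Q)"
      using PQ by (simp_all add: sub)
    show "K = (K - P) \<union> (K - Q)"
      using PQ(5) unfolding disjnt_def by blast
  qed (use PQ in blast)+
qed

text \<open>A content in the sense of Halmos, with no regularity demanded. The measure built from it
  may therefore exceed \<open>\<kappa>\<close> on compact sets; what is retained is the lower bound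
  \<open>content_le_measure\<close>, which suffices to show the measure non-zero.\<close>

locale compact_content =
  fixes X :: "'a topology" and \<kappa> :: "'a set \<Rightarrow> ennreal"
  assumes Hausdorff: "Hausdorff_space X"
    and locally_compact: "locally_compact_space X"
    and finite_content: "compactin X K \<Longrightarrow> \<kappa> K < \<infinity>"
    and content_mono: "compactin X K \<Longrightarrow> compactin X L \<Longrightarrow> K \<subseteq> L \<Longrightarrow> \<kappa> K \<le> \<kappa> L"
    and content_subadd: "compactin X K \<Longrightarrow> compactin X L \<Longrightarrow> \<kappa> (K \<union> L) \<le> \<kappa> K + \<kappa> L"
    and content_disjoint:
      "compactin X K \<Longrightarrow> compactin X L \<Longrightarrow> K \<inter> L = {} \<Longrightarrow> \<kappa> (K \<union> L) = \<kappa> K + \<kappa> L"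
begin

definition open_mass :: "'a set \<Rightarrow> ennreal" where
  "open_mass U = (SUP K\<in>{K. compactin X K \<and> K \<subseteq> U}. \<kappa> K)"

definition outer_mass :: "'a set \<Rightarrow> ennreal" where
  "outer_mass E = (INF U\<in>{U. openin X U \<and> E \<subseteq> U}. open_mass U)"

definition content_measure :: "'a measure" where
  "content_measure = measure_of (topspace X) {U. openin X U} outer_mass"

lemma content_empty: "\<kappa> {} = 0"
proof -
  have "\<kappa> {} + \<kappa> {} = \<kappa> {} + 0"
    using content_disjoint[of "{}" "{}"] by simp
  then show ?thesis
    using finite_content[of "{}"] ennreal_add_left_cancel[of "\<kappa> {}" "\<kappa> {}" 0] by auto
qed

lemma content_le_open_mass: "compactin X K \<Longrightarrow> K \<subseteq> U \<Longrightarrow> \<kappa> K \<le> open_mass U"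
  unfolding open_mass_def by (rule SUP_upper) blast

lemma open_mass_leI: "(\<And>K. compactin X K \<Longrightarrow> K \<subseteq> U \<Longrightarrow> \<kappa> K \<le> c) \<Longrightarrow> open_mass U \<le> c"
  unfolding open_mass_def by (rule SUP_least) blast

lemma open_mass_mono: "U \<subseteq> V \<Longrightarrow> open_mass U \<le> open_mass V"
  by (rule open_mass_leI) (meson content_le_open_mass order_trans)

lemma outer_mass_le_open_mass: "openin X U \<Longrightarrow> E \<subseteq> U \<Longrightarrow> outer_mass E \<le> open_mass U"
  unfolding outer_mass_def by (rule INF_lower) blast

lemma outer_mass_geI: "(\<And>U. openin X U \<Longrightarrow> E \<subseteq> U \<Longrightarrow> c \<le> open_mass U) \<Longrightarrow> c \<le> outer_mass E"
  unfolding outer_mass_def by (rule INF_greatest) blast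

lemma outer_mass_open: "openin X U \<Longrightarrow> outer_mass U = open_mass U"
  by (intro antisym outer_mass_le_open_mass outer_mass_geI open_mass_mono) auto

lemma outer_mass_mono: "E \<subseteq> F \<Longrightarrow> outer_mass E \<le> outer_mass F"
  by (rule outer_mass_geI) (meson outer_mass_le_open_mass order_trans)

lemma content_le_outer_mass: "compactin X K \<Longrightarrow> \<kappa> K \<le> outer_mass K"
  by (rule outer_mass_geI) (rule content_le_open_mass)

lemma outer_mass_empty: "outer_mass {} = 0"
proof -
  have "open_mass {} \<le> 0"
    by (rule open_mass_leI) (simp add: content_empty)
  then show ?thesis
    by (simp add: outer_mass_open)
qed

text \<open>Local compactness encloses \<open>K\<close> in an open set with compact hull
  \<open>L\<close>, and \<open>\<kappa> L\<close> bounds the outer mass of \<open>K\<close>.\<close>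

lemma outer_mass_compact_finite:
  assumes K: "compactin X K"
  shows "outer_mass K < \<infinity>"
proof -
  obtain U L where UL: "openin X U" "compactin X L" "K \<subseteq> U" "U \<subseteq> L"
    using locally_compact_space_compact_closed_compact[of X] Hausdorff locally_compact K by blast
  have "outer_mass K \<le> open_mass U"
    using UL(1,3) by (rule outer_mass_le_open_mass)
  also have "\<dots> \<le> \<kappa> L"
    using UL by (intro open_mass_leI content_mono) auto
  also have "\<dots> < \<infinity>"
    using UL(2) by (rule finite_content)
  finally show ?thesis .
qed

text \<open>Induction on the number of open sets: \<open>compactin_split\<close> separates off a
  compact part lying in the last one.\<close>

lemma content_finite_cover:
  fixes U :: "nat \<Rightarrow> 'a set"
  assumes "\<And>n. openin X (U n)" "compactin X K" "K \<subseteq> (\<Union>n<N. U n)"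
  shows "\<kappa> K \<le> (\<Sum>n<N. open_mass (U n))"
  using assms(2,3)
proof (induction N arbitrary: K)
  case 0
  then show ?case by (simp add: content_empty)
next
  case (Suc N)
  have op: "openin X (\<Union>n<N. U n)"
    using assms(1) by (intro openin_Union) auto
  have sub: "K \<subseteq> (\<Union>n<N. U n) \<union> U N"
    using Suc.prems(2) by (simp add: lessThan_Suc Un_commute)
  obtain A B where AB: "compactin X A" "compactin X B" "A \<subseteq> (\<Union>n<N. U n)" "B \<subseteq> U N" "K = A \<union> B"
    by (rule compactin_split[OF Hausdorff Suc.prems(1) op assms(1) sub])
  have "\<kappa> K \<le> \<kappa> A + \<kappa> B"
    unfolding AB(5) using AB(1,2) by (rule content_subadd)
  also have "\<dots> \<le> (\<Sum>n<N. open_mass (U n)) + open_mass (U N)"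
    by (intro add_mono Suc.IH AB content_le_open_mass)
  finally show ?case by simp
qed

lemma open_mass_countably_subadditive:
  assumes "\<And>n::nat. openin X (U n)"
  shows "open_mass (\<Union>n. U n) \<le> (\<Sum>n. open_mass (U n))"
proof (rule open_mass_leI)
  fix K assume K: "compactin X K" "K \<subseteq> (\<Union>n. U n)"
  have "\<exists>\<F>. finite \<F> \<and> \<F> \<subseteq> range U \<and> K \<subseteq> \<Union>\<F>"
    by (rule compactinD[OF K(1)]) (use assms K(2) in auto)
  then obtain T where T: "finite T" "K \<subseteq> \<Union>(U ` T)"
    by (metis finite_subset_image)
  obtain N where N: "T \<subseteq> {..<N}"
    using finite_nat_bounded[OF T(1)] by blast
  have "\<kappa> K \<le> (\<Sum>n<N. open_mass (U n))"
    by (rule content_finite_cover[OF assms K(1)]) (use T(2) N in blast)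
  also have "\<dots> \<le> (\<Sum>n. open_mass (U n))"
    by (rule sum_le_suminf) auto
  finally show "\<kappa> K \<le> (\<Sum>n. open_mass (U n))" .
qed

lemma outer_mass_countably_subadditive:
  assumes "\<And>n::nat. E n \<subseteq> topspace X"
  shows "outer_mass (\<Union>n. E n) \<le> (\<Sum>n. outer_mass (E n))"
proof (rule ennreal_le_epsilon)
  fix e :: real assume e: "0 < e" "(\<Sum>n. outer_mass (E n)) < top_class.top"
  \<comment> \<open>The errors \<open>e / 2^(n+1)\<close> add up to \<open>e\<close>. Finiteness of
    the sum makes each outer mass finite, so adding a positive error is a strict increase.\<close>
  have "\<exists>U. openin X U \<and> E n \<subseteq> U \<and> open_mass U < outer_mass (E n) + ennreal e * ennreal ((1/2) ^ Suc n)" for n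
  proof -
    have "outer_mass (E n) < top_class.top"
      using e(2) by (rule ennreal_suminf_lessD)
    moreover have "0 < ennreal e * ennreal ((1/2) ^ Suc n)"
      using e(1) by (simp add: ennreal_zero_less_mult_iff)
    ultimately have "outer_mass (E n) < outer_mass (E n) + ennreal e * ennreal ((1/2) ^ Suc n)"
      using ennreal_add_left_cancel_less[of "outer_mass (E n)" 0] by auto
    then show ?thesis
      unfolding outer_mass_def[of "E n"] INF_less_iff by blast
  qed
  then obtain U where U: "\<And>n. openin X (U n)" "\<And>n. E n \<subseteq> U n"
    "\<And>n. open_mass (U n) < outer_mass (E n) + ennreal e * ennreal ((1/2) ^ Suc n)"
    by metis
  have "outer_mass (\<Union>n. E n) \<le> open_mass (\<Union>n. U n)"
    by (rule outer_mass_le_open_mass) (use U in blast)+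
  also have "\<dots> \<le> (\<Sum>n. open_mass (U n))"
    by (rule open_mass_countably_subadditive[OF U(1)])
  also have "\<dots> \<le> (\<Sum>n. outer_mass (E n) + ennreal e * ennreal ((1/2) ^ Suc n))"
    by (rule suminf_le[OF less_imp_le[OF U(3)]]) auto
  also have "\<dots> = (\<Sum>n. outer_mass (E n)) + (\<Sum>n. ennreal e * ennreal ((1/2) ^ Suc n))"
    by (rule suminf_add[symmetric]) auto
  also have "\<dots> = (\<Sum>n. outer_mass (E n)) + e"
    unfolding ennreal_suminf_cmult
    by (subst suminf_ennreal_eq[OF zero_le_power power_half_series]) auto
  finally show "outer_mass (\<Union>n. E n) \<le> (\<Sum>n. outer_mass (E n)) + ennreal e" .
qed

lemma outer_measure_space_outer_mass: "outer_measure_space (Pow (topspace X)) outer_mass"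
  unfolding outer_measure_space_def positive_def increasing_def countably_subadditive_def
proof (intro conjI ballI allI impI)
  fix E :: "nat \<Rightarrow> 'a set" assume "range E \<subseteq> Pow (topspace X)"
  then show "outer_mass (\<Union>n. E n) \<le> (\<Sum>n. outer_mass (E n))"
    by (intro outer_mass_countably_subadditive) auto
qed (auto simp: outer_mass_empty intro: outer_mass_mono)

text \<open>For an open \<open>V\<close> around \<open>E\<close>, exhaust
  \<open>V \<inter> U\<close> by compact sets \<open>K\<close>. The part of \<open>E\<close> outside
  \<open>U\<close> lies in the open set \<open>V - K\<close>, which is exhausted by compact sets
  \<open>L\<close> disjoint from \<open>K\<close>. Additivity on \<open>K \<union> L\<close> and the
  suprema, first over \<open>L\<close> and then over \<open>K\<close>, give the Caratheodory
  inequality.\<close>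

lemma open_in_lambda_system:
  assumes U: "openin X U"
  shows "U \<in> lambda_system (topspace X) (Pow (topspace X)) outer_mass"
proof -
  have "outer_mass (U \<inter> E) + outer_mass ((topspace X - U) \<inter> E) \<le> outer_mass E" for E
  proof (rule outer_mass_geI)
    fix V assume V: "openin X V" "E \<subseteq> V"
    let ?r = "outer_mass ((topspace X - U) \<inter> E)"
    have "\<kappa> K + ?r \<le> open_mass V" if K: "compactin X K" "K \<subseteq> V \<inter> U" for K
    proof -
      have "openin X (V - K)"
        using V(1) compactin_imp_closedin[OF Hausdorff K(1)] by (rule openin_diff)
      then have "?r \<le> open_mass (V - K)"
        by (rule outer_mass_le_open_mass) (use V K in blast)
      then have "\<kappa> K + ?r \<le> \<kappa> K + (SUP L\<in>{L. compactin X L \<and> L \<subseteq> V - K}. \<kappa> L)"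
        unfolding open_mass_def by (rule add_left_mono)
      also have "\<dots> = (SUP L\<in>{L. compactin X L \<and> L \<subseteq> V - K}. \<kappa> K + \<kappa> L)"
        by (rule ennreal_SUP_add_right) (use compactin_empty in blast)
      also have "\<dots> \<le> open_mass V"
      proof (rule SUP_least)
        fix L assume "L \<in> {L. compactin X L \<and> L \<subseteq> V - K}"
        then have L: "compactin X L" "L \<subseteq> V" "K \<inter> L = {}" by auto
        have "\<kappa> K + \<kappa> L = \<kappa> (K \<union> L)"
          using content_disjoint[OF K(1) L(1,3)] by simp
        also have "\<dots> \<le> open_mass V"
          by (rule content_le_open_mass) (use K L in \<open>auto intro: compactin_Un\<close>)
        finally show "\<kappa> K + \<kappa> L \<le> open_mass V" .
      qed
      finally show ?thesis .
    qed
    then have "(SUP K\<in>{K. compactin X K \<and> K \<subseteq> V \<inter> U}. \<kappa> K + ?r) \<le> open_mass V"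
      by (intro SUP_least) blast
    moreover have "(SUP K\<in>{K. compactin X K \<and> K \<subseteq> V \<inter> U}. \<kappa> K + ?r) = open_mass (V \<inter> U) + ?r"
      unfolding open_mass_def by (rule ennreal_SUP_add_left) (use compactin_empty in blast)
    moreover have "outer_mass (U \<inter> E) \<le> open_mass (V \<inter> U)"
      by (rule outer_mass_le_open_mass) (use V U in auto)
    ultimately show "outer_mass (U \<inter> E) + ?r \<le> open_mass V"
      by (metis (no_types, lifting) add_right_mono order_trans)
  qed
  moreover have "outer_mass E \<le> outer_mass (U \<inter> E) + outer_mass ((topspace X - U) \<inter> E)"
    if E: "E \<subseteq> topspace X" for E
  proof -
    interpret algebra "topspace X" "Pow (topspace X)" by (rule algebra_Pow)
    have "subadditive (Pow (topspace X)) outer_mass"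
      using outer_measure_space_outer_mass unfolding outer_measure_space_def
      by (intro countably_subadditive_subadditive) auto
    then have "outer_mass ((U \<inter> E) \<union> ((topspace X - U) \<inter> E))
        \<le> outer_mass (U \<inter> E) + outer_mass ((topspace X - U) \<inter> E)"
      by (rule subadditiveD) (use E in auto)
    also have "(U \<inter> E) \<union> ((topspace X - U) \<inter> E) = E"
      using E by auto
    finally show ?thesis .
  qed
  ultimately show ?thesis
    using openin_subset[OF U] unfolding lambda_system_def by (auto intro: antisym)
qed

section \<open>The Borel measure of a content and its regularity\<close>

lemma sets_content_measure: "sets content_measure = sigma_sets (topspace X) {U. openin X U}"
  unfolding content_measure_def by (rule sets_measure_of) (auto dest: openin_subset)

text \<open>The Caratheodory-measurable sets form a sigma-algebra on which \<open>outer_mass\<close>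
  is a measure; it contains the open sets, hence all Borel sets.\<close>

lemma emeasure_content_measure:
  assumes "E \<in> sets content_measure"
  shows "emeasure content_measure E = outer_mass E"
proof -
  let ?L = "lambda_system (topspace X) (Pow (topspace X)) outer_mass"
  have L: "measure_space (topspace X) ?L outer_mass"
    by (rule sigma_algebra.caratheodory_lemma[OF sigma_algebra_Pow outer_measure_space_outer_mass])
  then have "sigma_sets (topspace X) {U. openin X U} \<subseteq> ?L"
    by (intro sigma_algebra.sigma_sets_subset) (auto simp: measure_space_def open_in_lambda_system)
  then have ms: "measure_space (topspace X) (sigma_sets (topspace X) {U. openin X U}) outer_mass"
    by (intro measure_down[OF L] sigma_algebra_sigma_sets) (auto dest: openin_subset)
  show ?thesis
    by (rule emeasure_measure_of[OF content_measure_def])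
       (use ms assms in \<open>auto simp: measure_space_def sets_content_measure dest: openin_subset\<close>)
qed

lemma compact_in_sets_content_measure: "compactin X K \<Longrightarrow> K \<in> sets content_measure"
proof -
  assume "compactin X K"
  then have K: "closedin X K" by (rule compactin_imp_closedin[OF Hausdorff])
  then have "topspace X - (topspace X - K) \<in> sigma_sets (topspace X) {U. openin X U}"
    by (intro sigma_sets.Compl sigma_sets.Basic) auto
  also have "topspace X - (topspace X - K) = K"
    using closedin_subset[OF K] by blast
  finally show ?thesis by (simp add: sets_content_measure)
qed

lemma open_in_sets_content_measure: "openin X U \<Longrightarrow> U \<in> sets content_measure"
  by (simp add: sets_content_measure sigma_sets.Basic)

lemma radon_content_measure: "radon_measure X content_measure"
  unfolding radon_measure_def
proof (intro conjI allI impI ballI)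
  show "sets content_measure = sets (sigma (topspace X) {U. openin X U})"
    unfolding sets_content_measure by (rule sets_measure_of[symmetric]) (auto dest: openin_subset)
  show "emeasure content_measure K < \<infinity>" if "compactin X K" for K
    using that by (simp add: emeasure_content_measure compact_in_sets_content_measure
        outer_mass_compact_finite del: infinity_ennreal_def)
  show "emeasure content_measure A = (INF U\<in>{U. openin X U \<and> A \<subseteq> U}. emeasure content_measure U)"
    if "A \<in> sets content_measure" for A
    using that by (simp add: emeasure_content_measure outer_mass_def[of A]
        open_in_sets_content_measure outer_mass_open)
  show "emeasure content_measure U = (SUP K\<in>{K. compactin X K \<and> K \<subseteq> U}. emeasure content_measure K)"
    if U: "openin X U" for U
  proof -
    \<comment> \<open>On compact subsets of \<open>U\<close>, the outer mass lies between
      \<open>\<kappa>\<close> and \<open>open_mass U\<close>, and the supremum of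
      \<open>\<kappa>\<close> over them is already \<open>open_mass U\<close>.\<close>
    have "(SUP K\<in>{K. compactin X K \<and> K \<subseteq> U}. outer_mass K) = open_mass U"
    proof (rule antisym)
      show "(SUP K\<in>{K. compactin X K \<and> K \<subseteq> U}. outer_mass K) \<le> open_mass U"
        by (rule SUP_least) (use U in \<open>auto intro: outer_mass_le_open_mass\<close>)
      show "open_mass U \<le> (SUP K\<in>{K. compactin X K \<and> K \<subseteq> U}. outer_mass K)"
        unfolding open_mass_def by (rule SUP_mono) (use content_le_outer_mass in blast)
    qed
    moreover have "(SUP K\<in>{K. compactin X K \<and> K \<subseteq> U}. emeasure content_measure K) =
        (SUP K\<in>{K. compactin X K \<and> K \<subseteq> U}. outer_mass K)"
      by (rule SUP_cong) (auto simp: emeasure_content_measure compact_in_sets_content_measure)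
    ultimately show ?thesis
      using U by (simp add: emeasure_content_measure open_in_sets_content_measure outer_mass_open)
  qed
qed

lemma content_le_measure: "compactin X K \<Longrightarrow> \<kappa> K \<le> emeasure content_measure K"
  by (simp add: emeasure_content_measure compact_in_sets_content_measure content_le_outer_mass)

section \<open>Invariance of the measure under homeomorphisms preserving the content\<close>

lemma image_in_sets_content_measure:
  assumes "homeomorphic_map X X f" "E \<in> sets content_measure"
  shows "f ` E \<in> sets content_measure"
  using assms(2) unfolding sets_content_measure
proof (induction rule: sigma_sets.induct)
  case (Basic U)
  then have "openin X (f ` U)"
    using assms(1) openin_subset[of X U] homeomorphic_map_openness_eq by blast
  then show ?case by (simp add: sigma_sets.Basic)
next
  case Empty
  then show ?case by (simp add: sigma_sets.Empty)
next
  case (Compl E)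
  have "E \<subseteq> topspace X"
    using Compl.hyps by (rule sigma_sets_into_sp[rotated]) (auto dest: openin_subset)
  \<comment> \<open>Images, unlike preimages, respect complements only because \<open>f\<close> is a
    bijection of the space.\<close>
  then have "f ` (topspace X - E) = topspace X - f ` E"
    using assms(1) inj_on_image_set_diff[of f "topspace X" "topspace X" E]
    by (simp add: homeomorphic_eq_everything_map)
  with Compl.IH show ?case by (simp add: sigma_sets.Compl)
next
  case (Union E)
  show ?case unfolding image_UN by (rule sigma_sets.Union) (rule Union.IH)
qed

lemma open_mass_le_image:
  assumes "continuous_map X X f" "\<And>K. compactin X K \<Longrightarrow> \<kappa> (f ` K) = \<kappa> K"
  shows "open_mass U \<le> open_mass (f ` U)"
proof (rule open_mass_leI)
  fix K assume K: "compactin X K" "K \<subseteq> U"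
  have "\<kappa> (f ` K) \<le> open_mass (f ` U)"
    by (rule content_le_open_mass) (use K assms(1) image_compactin in blast)+
  with assms(2)[OF K(1)] show "\<kappa> K \<le> open_mass (f ` U)" by simp
qed

text \<open>An open \<open>V\<close> around \<open>E\<close> is carried to the open set
  \<open>f V\<close> around \<open>f E\<close>. Mapping back by the content-preserving
  \<open>g\<close> shows that \<open>f V\<close> has no more mass than \<open>V\<close>. Exchanging
  \<open>f\<close> and \<open>g\<close> later gives the reverse inequality.\<close>

lemma outer_mass_image_le:
  assumes fg: "homeomorphic_maps X X f g" and inv: "\<And>K. compactin X K \<Longrightarrow> \<kappa> (g ` K) = \<kappa> K"
    and E: "E \<subseteq> topspace X"
  shows "outer_mass (f ` E) \<le> outer_mass E"
proof (rule outer_mass_geI)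
  fix V assume V: "openin X V" "E \<subseteq> V"
  have f: "homeomorphic_map X X f"
    using fg homeomorphic_map_maps by blast
  have gf: "g ` f ` K = K" if "K \<subseteq> topspace X" for K
  proof -
    have "g ` f ` K = (\<lambda>x. x) ` K"
      unfolding image_image
      by (rule image_cong[OF refl]) (use fg that in \<open>auto simp: homeomorphic_maps_def\<close>)
    then show ?thesis by simp
  qed
  have "openin X (f ` V)"
    using f V(1) openin_subset[OF V(1)] homeomorphic_map_openness_eq by blast
  then have "outer_mass (f ` E) \<le> open_mass (f ` V)"
    by (rule outer_mass_le_open_mass) (use V in blast)
  also have "\<dots> \<le> open_mass (g ` f ` V)"
    by (rule open_mass_le_image[OF _ inv]) (use fg in \<open>auto simp: homeomorphic_maps_def\<close>)
  also have "\<dots> = open_mass V"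
    by (simp add: gf[OF openin_subset[OF V(1)]])
  finally show "outer_mass (f ` E) \<le> open_mass V" .
qed

lemma emeasure_content_measure_image:
  assumes fg: "homeomorphic_maps X X f g"
    and inv: "\<And>K. compactin X K \<Longrightarrow> \<kappa> (f ` K) = \<kappa> K" "\<And>K. compactin X K \<Longrightarrow> \<kappa> (g ` K) = \<kappa> K"
    and E: "E \<in> sets content_measure"
  shows "emeasure content_measure (f ` E) = emeasure content_measure E"
proof -
  have f: "homeomorphic_map X X f"
    using fg homeomorphic_map_maps by blast
  have EX: "E \<subseteq> topspace X"
    using E unfolding sets_content_measure by (rule sigma_sets_into_sp[rotated]) (auto dest: openin_subset)
  have "outer_mass (f ` E) \<le> outer_mass E"
    by (rule outer_mass_image_le[OF fg inv(2) EX])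
  moreover have "outer_mass (g ` f ` E) \<le> outer_mass (f ` E)"
  proof (rule outer_mass_image_le[OF _ inv(1)])
    show "homeomorphic_maps X X g f"
      by (rule homeomorphic_maps_sym[THEN iffD1, OF fg])
    show "f ` E \<subseteq> topspace X"
      using fg EX by (auto simp: homeomorphic_maps_def continuous_map_def)
  qed
  moreover have "g ` f ` E = (\<lambda>x. x) ` E"
    unfolding image_image
    by (rule image_cong[OF refl]) (use fg EX in \<open>auto simp: homeomorphic_maps_def\<close>)
  ultimately show ?thesis
    using E image_in_sets_content_measure[OF f E] by (simp add: emeasure_content_measure)
qed

end

section \<open>Cocompact actions of supramenable groups\<close>

text \<open>Invariance is known for subsets of a single translate of \<open>A\<close>. Induction on
  \<open>S\<close> cuts off the part of \<open>B\<close> in one translate, where the mean is at most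
  1, and leaves a part covered by fewer translates.\<close>

lemma invariant_mean_finite_cover:
  fixes G (structure) and m :: "'a set \<Rightarrow> ennreal"
  assumes "group G" and A: "A \<subseteq> carrier G" and one: "m A = 1"
    and add: "\<And>B C. B \<inter> C = {} \<Longrightarrow> m (B \<union> C) = m B + m C"
    and inv: "\<And>B g s. g \<in> carrier G \<Longrightarrow> s \<in> carrier G \<Longrightarrow> B \<subseteq> (\<lambda>x. s \<otimes> x) ` A \<Longrightarrow>
       m ((\<lambda>x. g \<otimes> x) ` B) = m B"
    and S: "finite S" "S \<subseteq> carrier G" and B: "B \<subseteq> (\<Union>s\<in>S. (\<lambda>x. s \<otimes> x) ` A)"
  shows "m B < \<infinity> \<and> (\<forall>g\<in>carrier G. m ((\<lambda>x. g \<otimes> x) ` B) = m B)"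
  using S B
proof (induction S arbitrary: B rule: finite_induct)
  case empty
  \<comment> \<open>Additivity alone would allow \<open>m {}\<close> to be infinite; cancelling the
    finite value \<open>m A = 1\<close> excludes this.\<close>
  have "1 + m {} = 1 + 0"
    using add[of A "{}"] one by simp
  then have "m {} = 0"
    by (metis ennreal_add_left_cancel ennreal_one_neq_top infinity_ennreal_def)
  with empty show ?case by simp
next
  case (insert s S)
  interpret group G by fact
  let ?C = "B \<inter> (\<lambda>x. s \<otimes> x) ` A" and ?D = "B - (\<lambda>x. s \<otimes> x) ` A"
  have s: "s \<in> carrier G" "S \<subseteq> carrier G" using insert.prems(1) by auto
  have split: "B = ?C \<union> ?D" by blast
  have "?D \<subseteq> (\<Union>s\<in>S. (\<lambda>x. s \<otimes> x) ` A)"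
    using insert.prems(2) by blast
  then have D: "m ?D < \<infinity>" "\<And>g. g \<in> carrier G \<Longrightarrow> m ((\<lambda>x. g \<otimes> x) ` ?D) = m ?D"
    using insert.IH[OF s(2)] by blast+
  have mB: "m B = m ?C + m ?D"
    using add[of ?C ?D] split by (metis Diff_disjoint Int_Diff inf_commute Diff_Int_distrib2 Int_Diff_disjoint)
  have "m ((\<lambda>x. s \<otimes> x) ` A) = 1"
    using inv[of s \<one> A] A s(1) one by (force simp: image_iff)
  moreover have "m ((\<lambda>x. s \<otimes> x) ` A) = m ?C + m ((\<lambda>x. s \<otimes> x) ` A - B)"
    using add[of ?C "(\<lambda>x. s \<otimes> x) ` A - B"] by (metis Int_Diff_disjoint Int_Diff_Un inf_commute)
  ultimately have "m ?C \<le> 1"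
    by (metis le_iff_add)
  then have "m ?C < \<infinity>"
    by (rule order.strict_trans1) simp
  with D(1) mB have "m B < \<infinity>" by simp
  moreover have "m ((\<lambda>x. g \<otimes> x) ` B) = m B" if g: "g \<in> carrier G" for g
  proof -
    have BG: "B \<subseteq> carrier G"
    proof
      fix x assume "x \<in> B"
      then obtain t a where "t \<in> insert s S" "a \<in> A" "x = t \<otimes> a"
        using insert.prems(2) by blast
      then show "x \<in> carrier G"
        using insert.prems(1) A by auto
    qed
    have inj: "inj_on (\<lambda>x. g \<otimes> x) B"
      by (rule inj_on_subset[OF inj_on_cmult[OF g] BG])
    have "(\<lambda>x. g \<otimes> x) ` ?C \<inter> (\<lambda>x. g \<otimes> x) ` ?D = (\<lambda>x. g \<otimes> x) ` (?C \<inter> ?D)"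
      by (rule inj_on_image_Int[OF inj, symmetric]) auto
    also have "?C \<inter> ?D = {}" by blast
    finally have "m ((\<lambda>x. g \<otimes> x) ` ?C \<union> (\<lambda>x. g \<otimes> x) ` ?D) = m ((\<lambda>x. g \<otimes> x) ` ?C) + m ((\<lambda>x. g \<otimes> x) ` ?D)"
      by (intro add) simp
    moreover have "(\<lambda>x. g \<otimes> x) ` ?C \<union> (\<lambda>x. g \<otimes> x) ` ?D = (\<lambda>x. g \<otimes> x) ` B"
      by (simp only: image_Un[symmetric] split[symmetric])
    moreover have "m ((\<lambda>x. g \<otimes> x) ` ?C) = m ?C"
      by (rule inv[OF g s(1)]) blast
    ultimately show ?thesis
      using D(2)[OF g] mB by simp
  qed
  ultimately show ?case by blast
qed

lemma topological_action_homeomorphic_maps: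
  fixes G (structure)
  assumes "topological_action G X \<phi>" "g \<in> carrier G"
  shows "homeomorphic_maps X X (\<phi> g) (\<phi> (inv g))"
proof -
  interpret group_action G "topspace X" \<phi>
    using assms(1) by (simp add: topological_action_def)
  interpret group G
    using group_hom group_hom.axioms(1) by blast
  have one: "\<phi> \<one> x = x" if "x \<in> topspace X" for x
    using that by (simp flip: id_eq_one)
  have cont: "continuous_map X X (\<phi> h)" if "h \<in> carrier G" for h
    using assms(1) that by (simp add: topological_action_def homeomorphic_eq_everything_map)
  show ?thesis
    unfolding homeomorphic_maps_def
    using assms(2) by (auto simp: cont one composition_rule[symmetric])
qed

lemma invariant_radon_measure_exists:
  fixes G (structure)
  assumes "group G" "countable (carrier G)" "supramenable G"
    and X: "locally_compact_space X" "Hausdorff_space X" "topspace X \<noteq> {}"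
    and act: "topological_action G X \<phi>" and cocompact: "cocompact_action G X \<phi>"
  shows "has_nonzero_invariant_radon_measure G X \<phi>"
proof -
  interpret group G by fact
  interpret group_action G "topspace X" \<phi>
    using act by (simp add: topological_action_def)
  have one: "\<phi> \<one> x = x" if "x \<in> topspace X" for x
    using that by (simp flip: id_eq_one)
  have inv_cancel: "\<phi> (inv g) (\<phi> g x) = x" "\<phi> g (\<phi> (inv g) x) = x"
    if "g \<in> carrier G" "x \<in> topspace X" for g x
    using that by (simp_all add: composition_rule[symmetric] one)
  obtain K where K: "compactin X K" "(\<Union>g\<in>carrier G. \<phi> g ` K) = topspace X"
    using cocompact unfolding cocompact_action_def by blast
  \<comment> \<open>The open set \<open>U\<close> is there so that compactness yields finite covers
    by its translates; the compact set \<open>L\<close> is there to define \<open>A\<close>.\<close>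
  obtain U L where UL: "openin X U" "compactin X L" "K \<subseteq> U" "U \<subseteq> L"
    using locally_compact_space_compact_closed_compact[of X] X K(1) by blast
  obtain x0 where x0: "x0 \<in> topspace X" using X(3) by blast
  \<comment> \<open>\<open>\<pi>\<close> pulls sets back along the orbit map of \<open>x0\<close>.
    It is equivariant (\<open>\<pi>_image\<close>) and respects unions and disjointness, so the mean
    on the group becomes a content on the space.\<close>
  define \<pi> where "\<pi> B = {g \<in> carrier G. \<phi> g x0 \<in> B}" for B
  define A where "A = \<pi> L"
  have \<pi>_carrier: "\<pi> B \<subseteq> carrier G" for B
    by (auto simp: \<pi>_def)
  have \<pi>_image: "\<pi> (\<phi> s ` C) = (\<lambda>x. s \<otimes> x) ` \<pi> C" if s: "s \<in> carrier G" and C: "C \<subseteq> topspace X" for s C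
  proof (intro equalityI subsetI)
    fix g assume "g \<in> \<pi> (\<phi> s ` C)"
    then obtain c where g: "g \<in> carrier G" and c: "c \<in> C" "\<phi> g x0 = \<phi> s c"
      by (auto simp: \<pi>_def)
    have "\<phi> (inv s \<otimes> g) x0 = \<phi> (inv s) (\<phi> s c)"
      using s g x0 c by (simp add: composition_rule)
    also have "\<dots> = c" using inv_cancel(1)[OF s] c C by blast
    finally have "inv s \<otimes> g \<in> \<pi> C"
      using c s g by (simp add: \<pi>_def)
    moreover have "g = s \<otimes> (inv s \<otimes> g)"
      using s g by (simp add: m_assoc[symmetric])
    ultimately show "g \<in> (\<lambda>x. s \<otimes> x) ` \<pi> C" by blast
  next
    fix g assume "g \<in> (\<lambda>x. s \<otimes> x) ` \<pi> C"
    then obtain h where h: "h \<in> carrier G" "\<phi> h x0 \<in> C" "g = s \<otimes> h"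
      by (auto simp: \<pi>_def)
    then have "\<phi> g x0 = \<phi> s (\<phi> h x0)"
      using s x0 by (simp add: composition_rule)
    with h s show "g \<in> \<pi> (\<phi> s ` C)"
      by (auto simp: \<pi>_def)
  qed
  have A_ne: "A \<noteq> {}"
  proof -
    obtain g k where gk: "g \<in> carrier G" "k \<in> K" "x0 = \<phi> g k"
      using x0 K(2) by blast
    have "k \<in> topspace X" using gk(2) compactin_subset_topspace[OF K(1)] by blast
    then have "\<phi> (inv g) x0 = k"
      using gk by (simp add: inv_cancel)
    then have "inv g \<in> A"
      using gk UL(3,4) by (auto simp: A_def \<pi>_def)
    then show ?thesis by blast
  qed
  have A: "A \<subseteq> carrier G" unfolding A_def by (rule \<pi>_carrier)
  have A_np: "\<not> paradoxical G A"
    using assms(3) by (simp add: supramenable_def)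
  obtain m :: "'a set \<Rightarrow> ennreal" where m: "m A = 1"
    "\<And>B C. B \<inter> C = {} \<Longrightarrow> m (B \<union> C) = m B + m C"
    "\<And>B g s. g \<in> carrier G \<Longrightarrow> s \<in> carrier G \<Longrightarrow> B \<subseteq> (\<lambda>x. s \<otimes> x) ` A \<Longrightarrow>
       m ((\<lambda>x. g \<otimes> x) ` B) = m B"
  proof (rule invariant_mean[OF assms(1,2) A A_ne A_np])
    fix m :: "'a set \<Rightarrow> ennreal"
    assume "m A = 1" "\<And>B C. B \<inter> C = {} \<Longrightarrow> m (B \<union> C) = m B + m C"
      "\<And>B g s. g \<in> carrier G \<Longrightarrow> s \<in> carrier G \<Longrightarrow> B \<subseteq> (\<lambda>x. s \<otimes> x) ` A \<Longrightarrow>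
         m ((\<lambda>x. g \<otimes> x) ` B) = m B"
    then show thesis by (rule that[of m])
  qed
  \<comment> \<open>A compact set is covered by finitely many translates of \<open>U\<close>, hence
    of \<open>L\<close>; its pullback is then covered by finitely many translates of
    \<open>A\<close>, where the mean is finite and invariant.\<close>
  have compact: "m (\<pi> C) < \<infinity> \<and> (\<forall>g\<in>carrier G. m ((\<lambda>x. g \<otimes> x) ` \<pi> C) = m (\<pi> C))"
    if C: "compactin X C" for C
  proof -
    have "\<exists>\<F>. finite \<F> \<and> \<F> \<subseteq> (\<lambda>s. \<phi> s ` U) ` carrier G \<and> C \<subseteq> \<Union>\<F>"
    proof (rule compactinD[OF C])
      show "openin X V" if V: "V \<in> (\<lambda>s. \<phi> s ` U) ` carrier G" for V
      proof -
        obtain s where s: "s \<in> carrier G" "V = \<phi> s ` U" using V by blast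
        have "homeomorphic_map X X (\<phi> s)"
          using act s(1) by (simp add: topological_action_def)
        then have "openin X U = (U \<subseteq> topspace X \<and> openin X (\<phi> s ` U))"
          by (rule homeomorphic_map_openness_eq)
        with UL(1) s(2) show ?thesis by simp
      qed
      have "C \<subseteq> (\<Union>s\<in>carrier G. \<phi> s ` K)"
        using compactin_subset_topspace[OF C] K(2) by simp
      also have "\<dots> \<subseteq> (\<Union>s\<in>carrier G. \<phi> s ` U)"
        by (intro UN_mono image_mono subset_refl UL(3))
      finally show "C \<subseteq> \<Union> ((\<lambda>s. \<phi> s ` U) ` carrier G)" .
    qed
    then obtain \<F> where \<F>: "finite \<F>" "\<F> \<subseteq> (\<lambda>s. \<phi> s ` U) ` carrier G" "C \<subseteq> \<Union>\<F>"
      by blast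
    obtain S where S: "S \<subseteq> carrier G" "finite S" "\<F> = (\<lambda>s. \<phi> s ` U) ` S"
      using finite_subset_image[OF \<F>(1,2)] by blast
    have "C \<subseteq> (\<Union>s\<in>S. \<phi> s ` U)"
      using \<F>(3) S(3) by simp
    also have "\<dots> \<subseteq> (\<Union>s\<in>S. \<phi> s ` L)"
      by (intro UN_mono image_mono subset_refl UL(4))
    finally have "\<pi> C \<subseteq> (\<Union>s\<in>S. \<pi> (\<phi> s ` L))"
      unfolding \<pi>_def by blast
    also have "\<dots> = (\<Union>s\<in>S. (\<lambda>x. s \<otimes> x) ` A)"
      unfolding A_def using S(1) compactin_subset_topspace[OF UL(2)]
      by (intro SUP_cong refl \<pi>_image) auto
    finally have cover: "\<pi> C \<subseteq> (\<Union>s\<in>S. (\<lambda>x. s \<otimes> x) ` A)" .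
    show ?thesis
    proof (rule invariant_mean_finite_cover[where m = m, OF assms(1) A m(1) _ _ S(2,1) cover])
      show "m (B \<union> C) = m B + m C" if "B \<inter> C = {}" for B C
        using that by (rule m(2))
      show "m ((\<lambda>x. g \<otimes> x) ` B) = m B"
        if "g \<in> carrier G" "s \<in> carrier G" "B \<subseteq> (\<lambda>x. s \<otimes> x) ` A" for B g s
        using that by (rule m(3))
    qed
  qed
  have mono: "m B \<le> m C" if "B \<subseteq> C" for B C
  proof -
    have "m C = m B + m (C - B)"
      using m(2)[of B "C - B"] that by (simp add: Un_absorb1)
    then show ?thesis by (simp add: le_iff_add)
  qed
  interpret compact_content X "\<lambda>C. m (\<pi> C)"
  proof
    show "m (\<pi> C) < \<infinity>" if "compactin X C" for C
      using compact[OF that] by blast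
    show "m (\<pi> C) \<le> m (\<pi> D)" if "C \<subseteq> D" for C D
      using that by (intro mono) (auto simp: \<pi>_def)
    show "m (\<pi> (C \<union> D)) \<le> m (\<pi> C) + m (\<pi> D)" for C D
    proof -
      have "\<pi> (C \<union> D) = \<pi> C \<union> (\<pi> D - \<pi> C)"
        by (auto simp: \<pi>_def)
      then have "m (\<pi> (C \<union> D)) = m (\<pi> C) + m (\<pi> D - \<pi> C)"
        using m(2)[of "\<pi> C" "\<pi> D - \<pi> C"] by simp
      also have "\<dots> \<le> m (\<pi> C) + m (\<pi> D)"
        by (intro add_left_mono mono) blast
      finally show ?thesis .
    qed
    show "m (\<pi> (C \<union> D)) = m (\<pi> C) + m (\<pi> D)" if "C \<inter> D = {}" for C D
    proof -
      have "\<pi> (C \<union> D) = \<pi> C \<union> \<pi> D" "\<pi> C \<inter> \<pi> D = {}"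
        using that by (auto simp: \<pi>_def)
      then show ?thesis using m(2) by simp
    qed
  qed (rule X)+
  have \<pi>_invariant: "m (\<pi> (\<phi> g ` C)) = m (\<pi> C)" if "g \<in> carrier G" "compactin X C" for g C
    using compact[OF that(2)] that(1) by (simp add: \<pi>_image compactin_subset_topspace[OF that(2)])
  have "invariant_measure G \<phi> content_measure"
    unfolding invariant_measure_def
  proof (intro ballI)
    fix g E assume g: "g \<in> carrier G" and E: "E \<in> sets content_measure"
    show "emeasure content_measure (\<phi> g ` E) = emeasure content_measure E"
      by (rule emeasure_content_measure_image[OF topological_action_homeomorphic_maps[OF act g] _ _ E])
        (use g \<pi>_invariant in auto)
  qed
  moreover have "emeasure content_measure (topspace X) \<noteq> 0"
  proof -
    \<comment> \<open>The content of \<open>L\<close> is \<open>m A = 1\<close>, so the measure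
      cannot vanish.\<close>
    have "1 \<le> emeasure content_measure L"
      using content_le_measure[OF UL(2)] m(1) by (simp add: A_def)
    also have "\<dots> \<le> emeasure content_measure (topspace X)"
      by (intro emeasure_mono compactin_subset_topspace[OF UL(2)] open_in_sets_content_measure) simp
    finally show ?thesis by auto
  qed
  ultimately show ?thesis
    unfolding has_nonzero_invariant_radon_measure_def using radon_content_measure by blast
qed

section \<open>Products of increasing words\<close>

primrec word_product :: "('g, 'm) monoid_scheme \<Rightarrow> (nat \<Rightarrow> 'g) \<Rightarrow> nat list \<Rightarrow> 'g" where
  "word_product G s [] = \<one>\<^bsub>G\<^esub>"
| "word_product G s (j # js) = s j \<otimes>\<^bsub>G\<^esub> word_product G s js"

definition increasing_words :: "nat \<Rightarrow> nat list set" where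
  "increasing_words m = {js. sorted_wrt (<) js \<and> set js \<subseteq> {..<m}}"

lemma finite_increasing_words: "finite (increasing_words m)"
proof -
  have "increasing_words m \<subseteq> {js. set js \<subseteq> {..<m} \<and> distinct js}"
    by (auto simp: increasing_words_def strict_sorted_iff)
  then show ?thesis
    by (rule finite_subset) (simp add: finite_subset_distinct)
qed

text \<open>The letter \<open>m\<close>, being the largest one available, can only stand at the
  end.\<close>

lemma increasing_words_Suc:
  assumes "js \<in> increasing_words (Suc m)"
  obtains "js \<in> increasing_words m" | xs where "xs \<in> increasing_words m" "js = xs @ [m]"
proof (cases "m \<in> set js")
  case False
  then have "js \<in> increasing_words m"
    using assms by (auto simp: increasing_words_def less_Suc_eq)
  then show thesis by (rule that(1))
next
  case True
  then have "js \<noteq> []" by auto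
  then obtain xs l where js: "js = xs @ [l]"
    by (metis append_butlast_last_id)
  have sorted: "sorted_wrt (<) xs" "\<And>x. x \<in> set xs \<Longrightarrow> x < l" "l \<le> m"
    using assms by (auto simp: increasing_words_def js sorted_wrt_append)
  have "l = m"
    using True sorted(2)[of m] sorted(3) by (auto simp: js)
  moreover have "xs \<in> increasing_words m"
    using sorted \<open>l = m\<close> by (auto simp: increasing_words_def)
  ultimately show thesis using that(2) js by blast
qed

lemma word_product_closed:
  assumes "group G" "\<And>j. j \<in> set js \<Longrightarrow> s j \<in> carrier G"
  shows "word_product G s js \<in> carrier G"
proof -
  interpret group G by fact
  show ?thesis using assms(2) by (induction js) auto
qed

lemma word_product_append:
  assumes "group G" "\<And>j. j \<in> set (xs @ ys) \<Longrightarrow> s j \<in> carrier G"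
  shows "word_product G s (xs @ ys) = word_product G s xs \<otimes>\<^bsub>G\<^esub> word_product G s ys"
proof -
  interpret group G by fact
  show ?thesis
    using assms(2)
  proof (induction xs)
    case Nil
    then show ?case by (simp add: word_product_closed[OF assms(1)])
  next
    case (Cons x xs)
    then show ?case by (simp add: m_assoc word_product_closed[OF assms(1)])
  qed
qed

lemma word_product_cong:
  "(\<And>j. j \<in> set js \<Longrightarrow> s j = t j) \<Longrightarrow> word_product G s js = word_product G t js"
  by (induction js) auto

text \<open>The term \<open>s m\<close> is chosen outside the finite set of all \<open>u\<inverse> v\<close> with \<open>u\<close>, \<open>v\<close> products of
  increasing words in the earlier terms; comparing last letters then separates the words.\<close>

lemma independent_sequence:
  fixes G (structure)
  assumes "group G" "infinite (carrier G)"
  obtains s :: "nat \<Rightarrow> 'a" where "\<And>j. s j \<in> carrier G"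
    "\<And>m. inj_on (word_product G s) (increasing_words m)"
proof -
  interpret group G by fact
  define P where "P s m r \<longleftrightarrow> r \<in> carrier G \<and> (\<forall>xs\<in>increasing_words m. \<forall>ys\<in>increasing_words m.
      r \<noteq> inv (word_product G s xs) \<otimes> word_product G s ys)" for s :: "nat \<Rightarrow> 'a" and m r
  have "\<exists>s. \<forall>m. P s m (s m)"
  \<comment> \<open>The condition on the \<open>m\<close>-th term may read only earlier terms. It
    does, because \<open>increasing_words m\<close> uses only letters below
    \<open>m\<close>.\<close>
  proof (rule dependent_wellorder_choice)
    fix r and s t :: "nat \<Rightarrow> 'a" and m assume eq: "\<And>y. y < m \<Longrightarrow> s y = t y"
    have "word_product G s js = word_product G t js" if "js \<in> increasing_words m" for js
      using that eq by (intro word_product_cong) (auto simp: increasing_words_def)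
    then show "P s m r = P t m r"
      unfolding P_def by simp
  next
    fix m and s :: "nat \<Rightarrow> 'a"
    let ?bad = "(\<lambda>(xs, ys). inv (word_product G s xs) \<otimes> word_product G s ys) `
      (increasing_words m \<times> increasing_words m)"
    have "finite ?bad"
      by (simp add: finite_increasing_words)
    then obtain r where "r \<in> carrier G" "r \<notin> ?bad"
      using assms(2) by (meson finite_subset subsetI)
    then have "P s m r"
      unfolding P_def by (force simp: image_iff)
    then show "\<exists>r. P s m r" ..
  qed
  then obtain s where s: "\<And>m. P s m (s m)" by blast
  have closed: "s j \<in> carrier G" for j
    using s[of j] by (simp add: P_def)
  note wp_closed = word_product_closed[OF assms(1) closed, simp]
  \<comment> \<open>A coincidence would express \<open>s m\<close> as one of the excluded
    quotients.\<close>
  have new: "word_product G s (xs @ [m]) \<noteq> word_product G s ys"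
    if "xs \<in> increasing_words m" "ys \<in> increasing_words m" for xs ys m
  proof
    assume "word_product G s (xs @ [m]) = word_product G s ys"
    then have eq: "word_product G s xs \<otimes> s m = word_product G s ys"
      by (simp add: word_product_append[OF assms(1) closed] closed)
    have "s m = inv (word_product G s xs) \<otimes> (word_product G s xs \<otimes> s m)"
      by (simp add: m_assoc[symmetric] closed)
    then have "s m = inv (word_product G s xs) \<otimes> word_product G s ys"
      unfolding eq .
    with s[of m] that show False unfolding P_def by blast
  qed
  have "inj_on (word_product G s) (increasing_words m)" for m
  proof (induction m)
    case 0
    have "increasing_words 0 = {[]}" by (auto simp: increasing_words_def)
    then show ?case by simp
  next
    case (Suc m)
    show ?case
    proof (rule inj_onI)
      fix xs ys assume xs: "xs \<in> increasing_words (Suc m)" and ys: "ys \<in> increasing_words (Suc m)"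
        and eq: "word_product G s xs = word_product G s ys"
      from xs show "xs = ys"
      proof (cases rule: increasing_words_Suc)
        case 1
        note xs1 = this
        from ys show ?thesis
        proof (cases rule: increasing_words_Suc)
          case 1
          show ?thesis using Suc.IH eq xs1 1 by (rule inj_onD)
        next
          case (2 ys')
          then show ?thesis using new[OF 2(1) xs1] eq by simp
        qed
      next
        case (2 xs')
        note xs2 = this
        from ys show ?thesis
        proof (cases rule: increasing_words_Suc)
          case 1
          then show ?thesis using new[OF xs2(1) 1] eq xs2(2) by simp
        next
          case (2 ys')
          have "word_product G s xs' = word_product G s ys'"
            using eq closed by (simp add: xs2(2) 2(2) word_product_append[OF assms(1) closed])
          then have "xs' = ys'"
            using Suc.IH xs2(1) 2(1) by (simp add: inj_on_eq_iff)
          then show ?thesis by (simp add: xs2(2) 2(2))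
        qed
      qed
    qed
  qed
  with closed that show thesis by blast
qed

text \<open>\<open>B n k\<close> consists of the products of increasing words of length
  \<open>n\<close> with letters at least \<open>k\<close>. Whether the first letter is
  \<open>k\<close> gives the recursion. Distinct words have distinct products, so translates
  belonging to different first letters are disjoint.\<close>

lemma branching_sets:
  fixes G (structure)
  assumes "group G" "infinite (carrier G)"
  obtains s :: "nat \<Rightarrow> 'a" and B :: "nat \<Rightarrow> nat \<Rightarrow> 'a set" where
    "\<And>j. s j \<in> carrier G" "\<And>n k. B n k \<subseteq> carrier G" "\<And>k. B 0 k = {\<one>}"
    "\<And>n k. B n k \<subseteq> B n 0"
    "\<And>n k. B (Suc n) k = B (Suc n) (Suc k) \<union> (\<lambda>x. s k \<otimes> x) ` B n (Suc k)"
    "\<And>n i j. i \<noteq> j \<Longrightarrow> (\<lambda>x. s i \<otimes> x) ` B n (Suc i) \<inter> (\<lambda>x. s j \<otimes> x) ` B n (Suc j) = {}"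
proof -
  obtain s where s: "\<And>j. s j \<in> carrier G" "\<And>m. inj_on (word_product G s) (increasing_words m)"
    using independent_sequence[OF assms] by blast
  define W where "W n k = {js. sorted_wrt (<) js \<and> length js = n \<and> set js \<subseteq> {k..}}" for n k :: nat
  define B where "B n k = word_product G s ` W n k" for n k
  \<comment> \<open>Two given words have a common bound on their letters, so injectivity on each
    \<open>increasing_words m\<close> is enough.\<close>
  have inj: "js = js'" if "sorted_wrt (<) js" "sorted_wrt (<) js'" "word_product G s js = word_product G s js'"
    for js js'
  proof -
    obtain m where "set js \<union> set js' \<subseteq> {..<m}"
      using finite_nat_bounded[of "set js \<union> set js'"] by auto
    then have "js \<in> increasing_words m" "js' \<in> increasing_words m"
      using that by (auto simp: increasing_words_def)
    with s(2)[of m] that(3) show ?thesis by (simp add: inj_on_eq_iff)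
  qed
  have Cons: "j # js \<in> W (Suc n) k" if "js \<in> W n (Suc j)" "k \<le> j" for j js n k
    using that by (auto simp: W_def Suc_le_eq intro: less_imp_le order.trans)
  have shift: "(\<lambda>x. s j \<otimes> x) ` B n (Suc j) = (\<lambda>js. word_product G s (j # js)) ` W n (Suc j)" for j n
    by (simp add: B_def image_image)
  have W_Suc: "W (Suc n) k = W (Suc n) (Suc k) \<union> (\<lambda>js. k # js) ` W n (Suc k)" for n k
  proof (intro equalityI subsetI)
    fix js assume js: "js \<in> W (Suc n) k"
    then obtain i l where i: "js = i # l" by (auto simp: W_def length_Suc_conv)
    show "js \<in> W (Suc n) (Suc k) \<union> (\<lambda>js. k # js) ` W n (Suc k)"
    proof (cases "i = k")
      case True
      then have "l \<in> W n (Suc k)" using js i by (auto simp: W_def)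
      then show ?thesis using i True by blast
    next
      case False
      then have "k < i" using js i by (auto simp: W_def)
      then have "js \<in> W (Suc n) (Suc k)" using js i by (auto simp: W_def)
      then show ?thesis by blast
    qed
  next
    fix js assume "js \<in> W (Suc n) (Suc k) \<union> (\<lambda>js. k # js) ` W n (Suc k)"
    moreover have "W (Suc n) (Suc k) \<subseteq> W (Suc n) k"
      by (auto simp: W_def)
    ultimately show "js \<in> W (Suc n) k"
      using Cons by blast
  qed
  show thesis
  proof
    show "B n k \<subseteq> carrier G" for n k
      by (auto simp: B_def intro: word_product_closed[OF assms(1) s(1)])
    have "W 0 k = {[]}" for k by (auto simp: W_def)
    then show "B 0 k = {\<one>}" for k by (simp add: B_def)
    show "B n k \<subseteq> B n 0" for n k by (auto simp: B_def W_def)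
    show "B (Suc n) k = B (Suc n) (Suc k) \<union> (\<lambda>x. s k \<otimes> x) ` B n (Suc k)" for n k
      unfolding shift unfolding B_def W_Suc[of n k] by (simp add: image_Un image_image)
    show "(\<lambda>x. s i \<otimes> x) ` B n (Suc i) \<inter> (\<lambda>x. s j \<otimes> x) ` B n (Suc j) = {}" if ij: "i \<noteq> j" for n i j
    proof (rule ccontr)
      assume "\<not> ?thesis"
      then obtain x y where xy: "x \<in> W n (Suc i)" "y \<in> W n (Suc j)"
        "word_product G s (i # x) = word_product G s (j # y)"
        unfolding shift by blast
      have "sorted_wrt (<) (i # x)" "sorted_wrt (<) (j # y)"
        using Cons[OF xy(1), of 0] Cons[OF xy(2), of 0] by (auto simp: W_def)
      then have "i # x = j # y" using xy(3) by (rule inj)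
      with ij show False by simp
    qed
  qed (rule s(1))
qed

section \<open>Open invariant subsets of the Stone-Cech compactification\<close>

text \<open>This is the closure in the Stone-Cech compactification of the points of
  \<open>A \<inter> S\<close>, seen as principal ultrafilters.\<close>

definition clopen_of :: "'a set \<Rightarrow> 'a set \<Rightarrow> 'a filter set" where
  "clopen_of S A = {U \<in> ultrafilters_on S. eventually (\<lambda>x. x \<in> A) U}"

lemma openin_clopen_of: "openin (stone_cech S) (clopen_of S A)"
  unfolding clopen_of_def by (rule openin_stone_cech_basic)

lemma compactin_clopen_of: "compactin (stone_cech S) (clopen_of S A)"
proof -
  have "clopen_of S A = topspace (stone_cech S) - clopen_of S (- A)"
    by (auto simp: clopen_of_def ultrafilters_on_not)
  then have "closedin (stone_cech S) (clopen_of S A)"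
    by (metis openin_clopen_of closedin_topspace closedin_diff)
  then show ?thesis
    using compact_space_stone_cech closedin_compact_space by blast
qed

text \<open>The non-trivial inclusion is primeness: an ultrafilter containing a union contains one
  of the two sets.\<close>

lemma clopen_of_Un: "clopen_of S (A \<union> B) = clopen_of S A \<union> clopen_of S B"
proof -
  have "eventually (\<lambda>x. x \<in> A \<or> x \<in> B) U \<longleftrightarrow> eventually (\<lambda>x. x \<in> A) U \<or> eventually (\<lambda>x. x \<in> B) U"
    if "U \<in> ultrafilters_on S" for U
    using ultrafilters_on_not[OF that, of "\<lambda>x. x \<in> A \<or> x \<in> B"]
      ultrafilters_on_not[OF that, of "\<lambda>x. x \<in> A"] ultrafilters_on_not[OF that, of "\<lambda>x. x \<in> B"]
    by (simp add: eventually_conj_iff) blast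
  then show ?thesis by (auto simp: clopen_of_def)
qed

lemma clopen_of_disjoint:
  assumes "A \<inter> B = {}"
  shows "clopen_of S A \<inter> clopen_of S B = {}"
proof -
  have False if "U \<in> ultrafilters_on S" "eventually (\<lambda>x. x \<in> A) U" "eventually (\<lambda>x. x \<in> B) U" for U
  proof -
    have "eventually (\<lambda>x. False) U"
      using that(2,3) by eventually_elim (use assms in blast)
    with that(1) show False by (simp add: ultrafilters_on_def eventually_False)
  qed
  then show ?thesis by (auto simp: clopen_of_def)
qed

lemma clopen_of_mono: "A \<subseteq> B \<Longrightarrow> clopen_of S A \<subseteq> clopen_of S B"
  by (auto simp: clopen_of_def elim!: eventually_mono)

text \<open>The action is \<open>undefined\<close> outside \<open>X\<close>, hence the assumption
  that the clopen set lies in \<open>X\<close>. Every point of the translated set is reached by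
  pulling it back with \<open>inv g\<close>.\<close>

lemma stone_cech_action_clopen_of:
  fixes G (structure)
  assumes "group G" "g \<in> carrier G" "A \<subseteq> carrier G"
    and X: "clopen_of (carrier G) A \<subseteq> X" "X \<subseteq> ultrafilters_on (carrier G)"
  shows "stone_cech_action G X g ` clopen_of (carrier G) A =
    clopen_of (carrier G) ((\<lambda>x. g \<otimes> x) ` A)"
proof -
  interpret group G by fact
  let ?\<beta> = "ultrafilters_on (carrier G)"
  interpret group_action G ?\<beta> "stone_cech_action G ?\<beta>"
    using stone_cech_action(1)[OF assms(1)] by (simp add: topological_action_def)
  have act: "filtermap (\<lambda>h. k \<otimes> h) U \<in> ?\<beta>" if "k \<in> carrier G" "U \<in> ?\<beta>" for k U
    using element_image[OF that refl] that(2) by (simp add: stone_cech_action_def)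
  have into: "filtermap (\<lambda>h. k \<otimes> h) U \<in> clopen_of (carrier G) ((\<lambda>x. k \<otimes> x) ` B)"
    if "k \<in> carrier G" "U \<in> clopen_of (carrier G) B" for k U B
    using that act by (auto simp: clopen_of_def eventually_filtermap elim: eventually_mono)
  have cancel: "(\<lambda>x. inv g \<otimes> x) ` (\<lambda>x. g \<otimes> x) ` A = A"
  proof -
    have "(\<lambda>x. inv g \<otimes> x) ` (\<lambda>x. g \<otimes> x) ` A = (\<lambda>x. x) ` A"
      unfolding image_image
      by (rule image_cong[OF refl]) (use assms(2,3) in \<open>auto simp: m_assoc[symmetric]\<close>)
    then show ?thesis by simp
  qed
  show ?thesis
  proof (intro equalityI subsetI)
    fix V assume "V \<in> stone_cech_action G X g ` clopen_of (carrier G) A"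
    then obtain U where U: "U \<in> clopen_of (carrier G) A" "V = stone_cech_action G X g U"
      by blast
    then have "V = filtermap (\<lambda>h. g \<otimes> h) U"
      using X(1) by (auto simp: stone_cech_action_def)
    then show "V \<in> clopen_of (carrier G) ((\<lambda>x. g \<otimes> x) ` A)"
      using into[OF assms(2) U(1)] by simp
  next
    fix V assume V: "V \<in> clopen_of (carrier G) ((\<lambda>x. g \<otimes> x) ` A)"
    let ?U = "filtermap (\<lambda>h. inv g \<otimes> h) V"
    have U: "?U \<in> clopen_of (carrier G) A"
      using into[OF inv_closed[OF assms(2)] V] by (simp add: cancel)
    have ev: "eventually (\<lambda>h. h \<in> carrier G) V"
      using V by (simp add: clopen_of_def ultrafilters_on_def)
    have "filtermap (\<lambda>h. g \<otimes> (inv g \<otimes> h)) V = filtermap (\<lambda>h. h) V"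
      by (rule filtermap_eq_if_eventually_eq, rule eventually_mono[OF ev])
         (use assms(2) in \<open>simp add: m_assoc[symmetric]\<close>)
    then have "stone_cech_action G X g ?U = V"
      using U X(1) by (auto simp: stone_cech_action_def filtermap_filtermap filtermap_ident)
    then show "V \<in> stone_cech_action G X g ` clopen_of (carrier G) A"
      using U by (metis imageI)
  qed
qed

text \<open>For \<open>g \<noteq> 1\<close> and \<open>C\<close> maximal with \<open>g C \<inter> C = {}\<close>, the sets \<open>C\<close>, \<open>g C\<close> and \<open>g\<inverse> C\<close> cover
  the group; an ultrafilter fixed by \<open>g\<close> would contain all three.\<close>

lemma free_action_stone_cech:
  fixes G (structure)
  assumes "group G"
    and U: "U \<in> ultrafilters_on (carrier G)" and g: "g \<in> carrier G"
    and fix_U: "filtermap (\<lambda>h. g \<otimes> h) U = U"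
  shows "g = \<one>"
proof (rule ccontr)
  assume g1: "g \<noteq> \<one>"
  interpret group G by fact
  let ?\<C> = "{C. C \<subseteq> carrier G \<and> (\<forall>x\<in>C. g \<otimes> x \<notin> C)}"
  have "\<exists>C\<in>?\<C>. \<forall>D\<in>?\<C>. C \<subseteq> D \<longrightarrow> D = C"
  proof (rule subset_Zorn)
    fix \<D> assume \<D>: "subset.chain ?\<C> \<D>"
    have "\<Union>\<D> \<in> ?\<C>"
    proof -
      have sub: "\<D> \<subseteq> ?\<C>" and lin: "\<And>C D. C \<in> \<D> \<Longrightarrow> D \<in> \<D> \<Longrightarrow> C \<subseteq> D \<or> D \<subseteq> C"
        using \<D> by (auto simp: subset_chain_def)
      have "g \<otimes> x \<notin> D" if CD: "C \<in> \<D>" "D \<in> \<D>" "x \<in> C" for x C D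
        using lin[OF CD(1,2)] CD sub by blast
      then show ?thesis using sub by blast
    qed
    then show "\<exists>C\<in>?\<C>. \<forall>D\<in>\<D>. D \<subseteq> C"
      by (intro bexI[of _ "\<Union>\<D>"]) auto
  qed
  then obtain C where mem: "C \<in> ?\<C>" and maximal: "\<forall>D\<in>?\<C>. C \<subseteq> D \<longrightarrow> D = C"
    by (rule bexE)
  have C: "C \<subseteq> carrier G" "\<And>x. x \<in> C \<Longrightarrow> g \<otimes> x \<notin> C"
    using mem by simp_all
  have max: "D = C" if "D \<subseteq> carrier G" "\<forall>x\<in>D. g \<otimes> x \<notin> D" "C \<subseteq> D" for D
    using maximal that by simp
  \<comment> \<open>If all three memberships failed, \<open>insert x C\<close> would still be
    disjoint from its translate, against maximality; \<open>g \<noteq> \<one>\<close> is what rules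
    out \<open>g \<otimes> x = x\<close>.\<close>
  have cases: "x \<in> C \<or> g \<otimes> x \<in> C \<or> inv g \<otimes> x \<in> C" if x: "x \<in> carrier G" for x
  proof (rule ccontr)
    assume no: "\<not> ?thesis"
    have "g \<otimes> x \<noteq> x" using g g1 x by (metis r_cancel_one)
    moreover have "g \<otimes> y \<noteq> x" if "y \<in> C" for y
    proof
      assume "g \<otimes> y = x"
      then have "inv g \<otimes> x = y"
        using g C(1) that by (auto simp: m_assoc[symmetric])
      with no that show False by simp
    qed
    ultimately have "insert x C = C"
      using C no x by (intro max) auto
    with no show False by blast
  qed
  have shift: "eventually (\<lambda>h. P (g \<otimes> h)) U \<longleftrightarrow> eventually P U" for P
    using fix_U by (metis eventually_filtermap)
  have carr: "eventually (\<lambda>h. h \<in> carrier G) U"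
    using U by (simp add: ultrafilters_on_def)
  have "eventually (\<lambda>h. h \<in> C) U"
  proof (rule ccontr)
    assume "\<not> ?thesis"
    then have n1: "eventually (\<lambda>h. h \<notin> C) U"
      by (simp add: ultrafilters_on_not[OF U])
    then have n2: "eventually (\<lambda>h. g \<otimes> h \<notin> C) U"
      by (simp add: shift[of "\<lambda>h. h \<notin> C"])
    \<comment> \<open>Rewriting \<open>h\<close> as \<open>inv g \<otimes> (g \<otimes> h)\<close>
      lets invariance under \<open>g\<close> act as invariance under \<open>inv g\<close>.\<close>
    have "eventually (\<lambda>h. inv g \<otimes> (g \<otimes> h) \<notin> C) U"
      using n1 carr by eventually_elim (use g in \<open>simp add: m_assoc[symmetric]\<close>)
    then have n3: "eventually (\<lambda>h. inv g \<otimes> h \<notin> C) U"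
      by (simp add: shift[of "\<lambda>h. inv g \<otimes> h \<notin> C"])
    from n1 n2 n3 carr have "eventually (\<lambda>h. False) U"
      by eventually_elim (use cases in blast)
    with U show False by (simp add: ultrafilters_on_def eventually_False)
  qed
  moreover from this have "eventually (\<lambda>h. g \<otimes> h \<in> C) U"
    by (simp add: shift[of "\<lambda>h. h \<in> C"])
  ultimately have "eventually (\<lambda>h. False) U"
    by eventually_elim (use C(2) in blast)
  with U show False by (simp add: ultrafilters_on_def eventually_False)
qed

text \<open>The maps are restricted to \<open>X\<close> because elements of
  \<open>BijGroup X\<close> are extensional; invariance of \<open>X\<close> makes the restrictions
  bijections of \<open>X\<close>.\<close>

lemma topological_action_subtopology:
  fixes G (structure)
  assumes act: "topological_action G Y \<phi>" and X: "X \<subseteq> topspace Y"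
    and inv: "\<And>g. g \<in> carrier G \<Longrightarrow> \<phi> g ` X = X"
  shows "topological_action G (subtopology Y X) (\<lambda>g. restrict (\<phi> g) X)"
proof -
  interpret group_action G "topspace Y" \<phi>
    using act by (simp add: topological_action_def)
  interpret group G
    using group_hom group_hom.axioms(1) by blast
  have ts: "topspace (subtopology Y X) = X" using X by auto
  have bij: "restrict (\<phi> g) X \<in> Bij X" if g: "g \<in> carrier G" for g
  proof -
    have "inj_on (\<phi> g) X" by (rule inj_on_subset[OF inj_prop[OF g] X])
    then show ?thesis by (simp add: Bij_def bij_betw_def inv[OF g])
  qed
  have "group_action G X (\<lambda>g. restrict (\<phi> g) X)"
  proof (intro group_action.intro group_hom.intro group_hom_axioms.intro homI)
    fix g k assume gk: "g \<in> carrier G" "k \<in> carrier G"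
    show "restrict (\<phi> (g \<otimes> k)) X = restrict (\<phi> g) X \<otimes>\<^bsub>BijGroup X\<^esub> restrict (\<phi> k) X"
    proof
      fix x
      have "\<phi> k x \<in> X" if "x \<in> X" using inv[OF gk(2)] that by blast
      moreover have "\<phi> (g \<otimes> k) x = \<phi> g (\<phi> k x)" if "x \<in> X"
        using composition_rule[OF _ gk] that X by blast
      ultimately show "restrict (\<phi> (g \<otimes> k)) X x = (restrict (\<phi> g) X \<otimes>\<^bsub>BijGroup X\<^esub> restrict (\<phi> k) X) x"
        using bij gk by (simp add: BijGroup_def compose_def)
    qed
  qed (use bij is_group group_BijGroup in \<open>auto simp: BijGroup_def\<close>)
  moreover have "homeomorphic_map (subtopology Y X) (subtopology Y X) (restrict (\<phi> g) X)"
    if g: "g \<in> carrier G" for g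
  proof (rule homeomorphic_map_eq)
    show "homeomorphic_map (subtopology Y X) (subtopology Y X) (\<phi> g)"
    proof (rule homeomorphic_map_subtopologies)
      show "homeomorphic_map Y Y (\<phi> g)"
        using act g by (simp add: topological_action_def)
      show "\<phi> g ` (topspace Y \<inter> X) = topspace Y \<inter> X"
        using X by (simp add: Int_absorb1 inv[OF g])
    qed
  qed (simp add: ts)
  ultimately show ?thesis
    unfolding topological_action_def ts by blast
qed

section \<open>Vanishing of invariant Radon measures on the branching sets\<close>

lemma emeasure_infinite_equal_disjoint:
  assumes "range E \<subseteq> sets M" "disjoint_family E" "\<And>i::nat. emeasure M (E i) = c"
    and "(\<Union>i. E i) \<subseteq> D" "D \<in> sets M" "emeasure M D < \<infinity>"
  shows "c = 0"
proof (rule ccontr)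
  assume "c \<noteq> 0"
  \<comment> \<open>The first \<open>N\<close> disjoint sets already fit into \<open>D\<close>; a
    positive \<open>c\<close> would contradict the Archimedean property.\<close>
  have le: "of_nat N * c \<le> emeasure M D" for N
  proof -
    have "of_nat N * c = (\<Sum>i<N. emeasure M (E i))"
      by (simp add: assms(3))
    also have "\<dots> \<le> (\<Sum>i. emeasure M (E i))"
      by (rule sum_le_suminf) auto
    also have "\<dots> = emeasure M (\<Union>i. E i)"
      by (rule suminf_emeasure[OF assms(1,2)])
    also have "\<dots> \<le> emeasure M D"
      by (rule emeasure_mono[OF assms(4,5)])
    finally show ?thesis .
  qed
  have "c < \<infinity>"
    using le[of 1] assms(6) by (simp add: order.strict_trans1)
  then obtain r where r: "0 \<le> r" "c = ennreal r"
    by (cases c) auto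
  obtain d where d: "0 \<le> d" "emeasure M D = ennreal d"
    using assms(6) by (cases "emeasure M D") auto
  have "0 < r" using r \<open>c \<noteq> 0\<close> by (cases "r = 0") auto
  then obtain N where "d < real N * r"
    using reals_Archimedean3 by blast
  moreover have "ennreal (real N * r) \<le> ennreal d"
    using le[of N] r d by (simp add: ennreal_mult ennreal_of_nat_eq_real_of_nat)
  ultimately show False
    using d(1) by simp
qed

lemma no_invariant_radon_measure_branching:
  fixes G (structure)
  assumes "group G" "countable (carrier G)"
    and s: "\<And>j. s j \<in> carrier G" and BG: "\<And>n k. B n k \<subseteq> carrier G"
    and B0: "\<And>k. B 0 k = {\<one>}" and B_sub: "\<And>n k. B n k \<subseteq> B n 0"
    and B_Suc: "\<And>n k. B (Suc n) k = B (Suc n) (Suc k) \<union> (\<lambda>x. s k \<otimes> x) ` B n (Suc k)"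
    and disj: "\<And>n i j. i \<noteq> j \<Longrightarrow>
      (\<lambda>x. s i \<otimes> x) ` B n (Suc i) \<inter> (\<lambda>x. s j \<otimes> x) ` B n (Suc j) = {}"
    and X: "X = (\<Union>n. \<Union>g\<in>carrier G. clopen_of (carrier G) ((\<lambda>x. g \<otimes> x) ` B n 0))"
  shows "\<not> has_nonzero_invariant_radon_measure G (subtopology (stone_cech (carrier G)) X)
    (stone_cech_action G X)"
proof
  interpret group G by fact
  let ?cl = "clopen_of (carrier G)"
  let ?T = "subtopology (stone_cech (carrier G)) X"
  assume "has_nonzero_invariant_radon_measure G ?T (stone_cech_action G X)"
  then obtain M where radon: "radon_measure ?T M"
    and inv: "invariant_measure G (stone_cech_action G X) M"
    and nz: "emeasure M (topspace ?T) \<noteq> 0"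
    unfolding has_nonzero_invariant_radon_measure_def by blast
  have X\<beta>: "X \<subseteq> ultrafilters_on (carrier G)"
    unfolding X by (auto simp: clopen_of_def)
  have tsX: "topspace ?T = X" using X\<beta> by auto
  have "sets M = sets (sigma (topspace ?T) {U. openin ?T U})"
    using radon unfolding radon_measure_def by blast
  also have "\<dots> = sigma_sets (topspace ?T) {U. openin ?T U}"
    by (rule sets_measure_of) (blast dest: openin_subset)
  finally have setsM: "sets M = sigma_sets (topspace ?T) {U. openin ?T U}" .
  have meas: "?cl A \<in> sets M" if A: "?cl A \<subseteq> X" for A
  proof -
    have "openin ?T (?cl A)"
      unfolding openin_subtopology using A openin_clopen_of[of "carrier G" A] by blast
    then show ?thesis
      by (simp only: setsM sigma_sets.Basic mem_Collect_eq)
  qed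
  have fin: "emeasure M (?cl A) < \<infinity>" if A: "?cl A \<subseteq> X" for A
  proof -
    have "compactin ?T (?cl A)"
      using A by (simp add: compactin_subtopology compactin_clopen_of)
    then show ?thesis using radon unfolding radon_measure_def by blast
  qed
  have translate: "emeasure M (?cl ((\<lambda>x. g \<otimes> x) ` A)) = emeasure M (?cl A)"
    if "g \<in> carrier G" "A \<subseteq> carrier G" "?cl A \<subseteq> X" for g A
  proof -
    have "emeasure M (stone_cech_action G X g ` ?cl A) = emeasure M (?cl A)"
      using inv that(1) meas[OF that(3)] unfolding invariant_measure_def by blast
    then show ?thesis
      by (simp only: stone_cech_action_clopen_of[OF assms(1) that X\<beta>])
  qed
  have sub0: "?cl ((\<lambda>x. g \<otimes> x) ` B n 0) \<subseteq> X" if "g \<in> carrier G" for g n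
    using that unfolding X by blast
  have one: "(\<lambda>x. \<one> \<otimes> x) ` B n 0 = B n 0" for n
    using BG[of n 0] by (force simp: image_iff)
  have subB: "?cl (B n k) \<subseteq> X" for n k
    using clopen_of_mono[OF B_sub[of n k], of "carrier G"] sub0[OF one_closed, of n] unfolding one
    by (rule order_trans)
  have shift_sub: "(\<lambda>x. s k \<otimes> x) ` B n (Suc k) \<subseteq> B (Suc n) 0" for n k
  proof -
    have "(\<lambda>x. s k \<otimes> x) ` B n (Suc k) \<subseteq> B (Suc n) k"
      unfolding B_Suc[of n k] by (rule Un_upper2)
    then show ?thesis using B_sub[of "Suc n" k] by (rule order_trans)
  qed
  have shiftX: "?cl ((\<lambda>x. s k \<otimes> x) ` B n (Suc k)) \<subseteq> X" for n k
    by (rule order_trans[OF clopen_of_mono[OF shift_sub] subB])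
  have shift_eq: "emeasure M (?cl ((\<lambda>x. s k \<otimes> x) ` B n (Suc k))) = emeasure M (?cl (B n (Suc k)))" for n k
    by (rule translate[OF s BG subB])
  \<comment> \<open>If the mass of \<open>B n k\<close> does not depend on \<open>k\<close>, then
    the translates of the \<open>B n (Suc j)\<close> by \<open>s j\<close> are infinitely many
    disjoint sets of equal mass inside \<open>B (Suc n) 0\<close>, whose closure is compact and so
    of finite mass.\<close>
  have zero: "emeasure M (?cl (B n k)) = 0"
    if const: "\<And>k. emeasure M (?cl (B n k)) = emeasure M (?cl (B n 0))" for n k
  proof -
    have "emeasure M (?cl (B n 0)) = 0"
    proof (rule emeasure_infinite_equal_disjoint)
      show "range (\<lambda>j. ?cl ((\<lambda>x. s j \<otimes> x) ` B n (Suc j))) \<subseteq> sets M"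
        using meas[OF shiftX] by blast
      show "disjoint_family (\<lambda>j. ?cl ((\<lambda>x. s j \<otimes> x) ` B n (Suc j)))"
        unfolding disjoint_family_on_def using clopen_of_disjoint[OF disj] by blast
      show "emeasure M (?cl ((\<lambda>x. s j \<otimes> x) ` B n (Suc j))) = emeasure M (?cl (B n 0))" for j
        unfolding shift_eq by (rule const)
      show "(\<Union>j. ?cl ((\<lambda>x. s j \<otimes> x) ` B n (Suc j))) \<subseteq> ?cl (B (Suc n) 0)"
        by (rule UN_least, rule clopen_of_mono, rule shift_sub)
      show "?cl (B (Suc n) 0) \<in> sets M" "emeasure M (?cl (B (Suc n) 0)) < \<infinity>"
        using meas[OF subB] fin[OF subB] by blast+
    qed
    then show ?thesis using const[of k] by simp
  qed
  have null: "emeasure M (?cl (B n k)) = 0" for n k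
  proof (induction n arbitrary: k)
    case 0
    show ?case by (rule zero) (simp add: B0)
  next
    case (Suc n)
    \<comment> \<open>\<open>B (Suc n) k\<close> exceeds \<open>B (Suc n) (Suc k)\<close> by at most
      a translate of \<open>B n (Suc k)\<close>, which is null by induction. Hence the mass does not
      depend on \<open>k\<close> at this level either.\<close>
    have step: "emeasure M (?cl (B (Suc n) k)) = emeasure M (?cl (B (Suc n) (Suc k)))" for k
    proof -
      have "?cl ((\<lambda>x. s k \<otimes> x) ` B n (Suc k)) \<in> null_sets M"
        using meas[OF shiftX] shift_eq Suc.IH by (simp add: null_sets_def)
      then show ?thesis
        unfolding B_Suc[of n k] clopen_of_Un
        using meas[OF subB] by (rule emeasure_Un_null_set[rotated])
    qed
    have "emeasure M (?cl (B (Suc n) k)) = emeasure M (?cl (B (Suc n) 0))" for k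
      by (induction k) (simp_all only: step[symmetric])
    then show ?case by (rule zero)
  qed
  \<comment> \<open>The group is countable, so \<open>X\<close> is a countable union of translates
    of null sets.\<close>
  have "X \<in> null_sets M"
    unfolding X
  proof (rule null_sets_UN', simp, rule null_sets_UN'[OF assms(2)])
    fix n g assume g: "g \<in> carrier G"
    have "emeasure M (?cl ((\<lambda>x. g \<otimes> x) ` B n 0)) = 0"
      unfolding translate[OF g BG subB] by (rule null)
    then show "?cl ((\<lambda>x. g \<otimes> x) ` B n 0) \<in> null_sets M"
      using meas[OF sub0[OF g]] by (simp add: null_sets_def)
  qed
  with nz tsX show False by (simp add: null_sets_def)
qed

section \<open>Dense orbit, assembly of the space, and the cocompact case\<close>

lemma has_dense_orbit_stone_cech:
  fixes G (structure)
  assumes "group G" and X: "X \<subseteq> ultrafilters_on (carrier G)"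
    and one: "principal {\<one>} \<in> X" and inv: "\<And>g. g \<in> carrier G \<Longrightarrow> stone_cech_action G X g ` X = X"
  shows "has_dense_orbit G (subtopology (stone_cech (carrier G)) X) (stone_cech_action G X)"
proof -
  interpret group G by fact
  let ?T = "subtopology (stone_cech (carrier G)) X"
  have tsX: "topspace ?T = X" using X by auto
  have "stone_cech_action G X g (principal {\<one>}) = principal {g}" if "g \<in> carrier G" for g
    using that one by (simp add: stone_cech_action_def filtermap_principal)
  \<comment> \<open>The orbit of the principal ultrafilter at the identity is the embedded group,
    which is dense.\<close>
  then have orb: "orbit G (stone_cech_action G X) (principal {\<one>}) = (\<lambda>g. principal {g}) ` carrier G"
    unfolding orbit_def by (auto simp: image_iff) metis+
  have "(\<lambda>g. principal {g}) ` carrier G \<subseteq> X"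
    unfolding orb[symmetric] orbit_def using inv one by blast
  then have "X \<inter> (\<lambda>g. principal {g}) ` carrier G = (\<lambda>g. principal {g}) ` carrier G"
    by blast
  then have "?T closure_of orbit G (stone_cech_action G X) (principal {\<one>}) = topspace ?T"
    unfolding orb closure_of_subtopology tsX
    using X by (simp add: dense_stone_cech Int_absorb2)
  with one tsX show ?thesis
    unfolding has_dense_orbit_def by blast
qed

lemma free_action_without_invariant_radon_measure:
  fixes G (structure)
  assumes "group G" "infinite (carrier G)" "countable (carrier G)"
  obtains X where "openin (stone_cech (carrier G)) X"
    "\<And>g. g \<in> carrier G \<Longrightarrow> stone_cech_action G (topspace (stone_cech (carrier G))) g ` X = X"
    "locally_compact_space (subtopology (stone_cech (carrier G)) X)"
    "sigma_compact_space (subtopology (stone_cech (carrier G)) X)"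
    "Hausdorff_space (subtopology (stone_cech (carrier G)) X)"
    "topological_action G (subtopology (stone_cech (carrier G)) X) (stone_cech_action G X)"
    "free_action G (subtopology (stone_cech (carrier G)) X) (stone_cech_action G X)"
    "has_dense_orbit G (subtopology (stone_cech (carrier G)) X) (stone_cech_action G X)"
    "\<not> has_nonzero_invariant_radon_measure G (subtopology (stone_cech (carrier G)) X)
       (stone_cech_action G X)"
proof -
  interpret group G by fact
  let ?cl = "clopen_of (carrier G)" and ?\<beta> = "ultrafilters_on (carrier G)"
  obtain s :: "nat \<Rightarrow> 'a" and B :: "nat \<Rightarrow> nat \<Rightarrow> 'a set" where sB:
    "\<And>j. s j \<in> carrier G" "\<And>n k. B n k \<subseteq> carrier G" "\<And>k. B 0 k = {\<one>}"
    "\<And>n k. B n k \<subseteq> B n 0"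
    "\<And>n k. B (Suc n) k = B (Suc n) (Suc k) \<union> (\<lambda>x. s k \<otimes> x) ` B n (Suc k)"
    "\<And>n i j. i \<noteq> j \<Longrightarrow> (\<lambda>x. s i \<otimes> x) ` B n (Suc i) \<inter> (\<lambda>x. s j \<otimes> x) ` B n (Suc j) = {}"
  proof (rule branching_sets[OF assms(1,2)])
    fix s :: "nat \<Rightarrow> 'a" and B :: "nat \<Rightarrow> nat \<Rightarrow> 'a set"
    assume "\<And>j. s j \<in> carrier G" "\<And>n k. B n k \<subseteq> carrier G" "\<And>k. B 0 k = {\<one>}"
      "\<And>n k. B n k \<subseteq> B n 0"
      "\<And>n k. B (Suc n) k = B (Suc n) (Suc k) \<union> (\<lambda>x. s k \<otimes> x) ` B n (Suc k)"
      "\<And>n i j. i \<noteq> j \<Longrightarrow> (\<lambda>x. s i \<otimes> x) ` B n (Suc i) \<inter> (\<lambda>x. s j \<otimes> x) ` B n (Suc j) = {}"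
    then show thesis by (rule that[of s B])
  qed
  define X where "X = (\<Union>n. \<Union>g\<in>carrier G. ?cl ((\<lambda>x. g \<otimes> x) ` B n 0))"
  let ?T = "subtopology (stone_cech (carrier G)) X"
  have op: "openin (stone_cech (carrier G)) X"
    unfolding X_def by (intro openin_Union) (auto intro: openin_clopen_of openin_Union)
  have X\<beta>: "X \<subseteq> ?\<beta>"
    using openin_subset[OF op] by simp
  have tsX: "topspace ?T = X" using X\<beta> by auto
  have act\<beta>: "topological_action G (stone_cech (carrier G)) (stone_cech_action G ?\<beta>)"
    using stone_cech_action(1)[OF assms(1)] by simp
  have sub: "?cl ((\<lambda>x. g \<otimes> x) ` B n 0) \<subseteq> ?\<beta>" for g n
    by (auto simp: clopen_of_def)
  have inv_le: "stone_cech_action G ?\<beta> h ` X \<subseteq> X" if h: "h \<in> carrier G" for h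
  proof -
    have "stone_cech_action G ?\<beta> h ` ?cl ((\<lambda>x. g \<otimes> x) ` B n 0) \<subseteq> X" if g: "g \<in> carrier G" for g n
    proof -
      have "(\<lambda>x. g \<otimes> x) ` B n 0 \<subseteq> carrier G" using sB(2)[of n 0] g by auto
      then have "stone_cech_action G ?\<beta> h ` ?cl ((\<lambda>x. g \<otimes> x) ` B n 0) =
          ?cl ((\<lambda>x. h \<otimes> x) ` (\<lambda>x. g \<otimes> x) ` B n 0)"
        by (rule stone_cech_action_clopen_of[OF assms(1) h _ sub order_refl])
      also have "(\<lambda>x. h \<otimes> x) ` (\<lambda>x. g \<otimes> x) ` B n 0 = (\<lambda>x. (h \<otimes> g) \<otimes> x) ` B n 0"
        unfolding image_image
        by (rule image_cong[OF refl]) (use sB(2)[of n 0] g h in \<open>auto simp: m_assoc\<close>)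
      also have "?cl \<dots> \<subseteq> X"
        unfolding X_def using m_closed[OF h g] by blast
      finally show ?thesis .
    qed
    then show ?thesis
      unfolding X_def image_UN by (intro UN_least) (simp add: X_def)
  qed
  \<comment> \<open>The inclusion \<open>inv_le\<close> for \<open>inv h\<close> supplies the
    reverse inclusion for \<open>h\<close>.\<close>
  have inv: "stone_cech_action G ?\<beta> h ` X = X" if h: "h \<in> carrier G" for h
  proof (rule antisym[OF inv_le[OF h]])
    have maps: "homeomorphic_maps (stone_cech (carrier G)) (stone_cech (carrier G))
        (stone_cech_action G ?\<beta> h) (stone_cech_action G ?\<beta> (inv h))"
      by (rule topological_action_homeomorphic_maps[OF act\<beta> h])
    show "X \<subseteq> stone_cech_action G ?\<beta> h ` X"
    proof
      fix U assume U: "U \<in> X"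
      have "stone_cech_action G ?\<beta> (inv h) U \<in> X"
        using inv_le[OF inv_closed[OF h]] U by blast
      moreover have "U = stone_cech_action G ?\<beta> h (stone_cech_action G ?\<beta> (inv h) U)"
        using maps U X\<beta> by (auto simp: homeomorphic_maps_def)
      ultimately show "U \<in> stone_cech_action G ?\<beta> h ` X"
        by (metis imageI)
    qed
  qed
  have restr: "stone_cech_action G X = (\<lambda>g. restrict (stone_cech_action G ?\<beta> g) X)"
    using X\<beta> by (auto simp: stone_cech_action_def fun_eq_iff)
  have inv': "stone_cech_action G X h ` X = X" if "h \<in> carrier G" for h
    unfolding restr using inv[OF that] by simp
  have haus: "Hausdorff_space ?T"
    using Hausdorff_space_stone_cech by (rule Hausdorff_space_subtopology)
  have lc: "locally_compact_space ?T"
    by (rule locally_compact_space_open_subset[OF _ _ op])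
      (use Hausdorff_space_stone_cech compact_space_stone_cech compact_imp_locally_compact_space in blast)+
  have sc: "sigma_compact_space ?T"
  proof -
    \<comment> \<open>The defining compact pieces of \<open>X\<close> are indexed by the countable
      set of pairs \<open>(n, g)\<close>; \<open>sigma_compact_space\<close> asks for an enumeration
      by natural numbers.\<close>
    let ?I = "(UNIV :: nat set) \<times> carrier G"
    define c where "c = (\<lambda>(n, g). ?cl ((\<lambda>x. g \<otimes> x) ` B n 0))"
    have I: "?I \<noteq> {}" "countable ?I"
      using assms(3) one_closed by auto
    have "(\<Union>i. c (from_nat_into ?I i)) = (\<Union>p\<in>?I. c p)"
      using range_from_nat_into[OF I] by (metis image_image)
    also have "\<dots> = X"
      unfolding X_def c_def by auto
    finally have un: "(\<Union>i. c (from_nat_into ?I i)) = topspace ?T"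
      by (simp only: tsX)
    have "compactin ?T (c (from_nat_into ?I i))" for i
    proof -
      have "c (from_nat_into ?I i) \<subseteq> X"
        using un unfolding tsX by blast
      moreover have "compactin (stone_cech (carrier G)) (c (from_nat_into ?I i))"
        by (simp add: c_def compactin_clopen_of split: prod.split)
      ultimately show ?thesis by (simp add: compactin_subtopology)
    qed
    with un show ?thesis
      unfolding sigma_compact_space_def by (intro exI[of _ "\<lambda>i. c (from_nat_into ?I i)"]) simp
  qed
  have act: "topological_action G ?T (stone_cech_action G X)"
    unfolding restr
    by (rule topological_action_subtopology[OF act\<beta> _ inv]) (use X\<beta> in simp)
  have free: "free_action G ?T (stone_cech_action G X)"
    unfolding free_action_def tsX
  proof (intro ballI impI)
    fix g U assume g: "g \<in> carrier G" and U: "U \<in> X" and "stone_cech_action G X g U = U"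
    then have "filtermap (\<lambda>h. g \<otimes> h) U = U"
      by (simp add: stone_cech_action_def)
    then show "g = \<one>"
      using free_action_stone_cech[OF assms(1) _ g] U X\<beta> by blast
  qed
  \<comment> \<open>\<open>B 0 0 = {\<one>}\<close> puts the identity, and with it the base point of
    the dense orbit, into \<open>X\<close>.\<close>
  have "principal {\<one>} \<in> ?cl ((\<lambda>x. \<one> \<otimes> x) ` B 0 0)"
    by (simp add: clopen_of_def sB(3) principal_in_ultrafilters_on eventually_principal)
  then have "principal {\<one>} \<in> X"
    unfolding X_def using one_closed by blast
  then have dense: "has_dense_orbit G ?T (stone_cech_action G X)"
    by (rule has_dense_orbit_stone_cech[OF assms(1) X\<beta> _ inv'])
  have "\<not> has_nonzero_invariant_radon_measure G ?T (stone_cech_action G X)"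
    by (rule no_invariant_radon_measure_branching[where s = s and B = B, OF assms(1,3) _ _ _ _ _ _ X_def])
       (fact sB)+
  with op inv lc sc haus act free dense show thesis
    by (intro that[of X]) simp_all
qed

text \<open>The second half speaks about every space with the listed properties, over an arbitrary
  type \<open>'x\<close> of points; taking filters on \<open>'g\<close> for \<open>'x\<close>
  includes the space of the first half.\<close>

theorem proposition4p3:
  fixes G :: "('g, 'm) monoid_scheme"
  assumes "group G" and "infinite (carrier G)" and "countable (carrier G)"
  shows
    "(\<exists>X. openin (stone_cech (carrier G)) X \<and>
          (\<forall>g\<in>carrier G. stone_cech_action G (topspace (stone_cech (carrier G))) g ` X = X) \<and>
          (let T = subtopology (stone_cech (carrier G)) X; \<phi> = stone_cech_action G X in
             locally_compact_space T \<and> sigma_compact_space T \<and> Hausdorff_space T \<and>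
             topological_action G T \<phi> \<and> free_action G T \<phi> \<and> has_dense_orbit G T \<phi> \<and>
             \<not> has_nonzero_invariant_radon_measure G T \<phi>)) \<and>
     (supramenable G \<longrightarrow>
       (\<forall>(T :: 'x topology) \<phi>.
          locally_compact_space T \<and> sigma_compact_space T \<and> Hausdorff_space T \<and>
          topological_action G T \<phi> \<and> free_action G T \<phi> \<and> has_dense_orbit G T \<phi> \<and>
          \<not> has_nonzero_invariant_radon_measure G T \<phi>
          \<longrightarrow> \<not> cocompact_action G T \<phi>))"
proof (rule conjI)
  show "\<exists>X. openin (stone_cech (carrier G)) X \<and>
          (\<forall>g\<in>carrier G. stone_cech_action G (topspace (stone_cech (carrier G))) g ` X = X) \<and>
          (let T = subtopology (stone_cech (carrier G)) X; \<phi> = stone_cech_action G X in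
             locally_compact_space T \<and> sigma_compact_space T \<and> Hausdorff_space T \<and>
             topological_action G T \<phi> \<and> free_action G T \<phi> \<and> has_dense_orbit G T \<phi> \<and>
             \<not> has_nonzero_invariant_radon_measure G T \<phi>)"
    unfolding Let_def
    by (rule free_action_without_invariant_radon_measure[OF assms]) (intro exI conjI ballI, assumption+)
  show "supramenable G \<longrightarrow>
       (\<forall>(T :: 'x topology) \<phi>.
          locally_compact_space T \<and> sigma_compact_space T \<and> Hausdorff_space T \<and>
          topological_action G T \<phi> \<and> free_action G T \<phi> \<and> has_dense_orbit G T \<phi> \<and>
          \<not> has_nonzero_invariant_radon_measure G T \<phi>
          \<longrightarrow> \<not> cocompact_action G T \<phi>)"
  proof (intro impI allI notI, elim conjE)
    fix T :: "'x topology" and \<phi>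
    assume "supramenable G" "locally_compact_space T" "Hausdorff_space T"
      "topological_action G T \<phi>" "has_dense_orbit G T \<phi>" "cocompact_action G T \<phi>"
      and none: "\<not> has_nonzero_invariant_radon_measure G T \<phi>"
    \<comment> \<open>A dense orbit provides a point of the space, which serves as the base point
      for pulling the content back.\<close>
    moreover from this have "topspace T \<noteq> {}"
      by (auto simp: has_dense_orbit_def)
    ultimately have "has_nonzero_invariant_radon_measure G T \<phi>"
      by (intro invariant_radon_measure_exists[OF assms(1,3)])
    with none show False by contradiction
  qed
qed

end
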